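(* Let $\Gamma$ be a bipartite distance-regular graph with vertex set $X$, diameter $D\ge4$ and valency $k\ge3$, fix $x\in X$, and let $T=T(x)$. Assume that up to isomorphism there are exactly two irreducible $T$-modules with endpoint $2$, and they are both thin. Let $2\le i\le D-2$ and let $\alpha_i,\beta_i,\gamma_i$ be complex scalars, not all zero, such that for all $y,z\in X$ with $\partial(x,y)=2$, $\partial(x,z)=i$, $\partial(y,z)=i$, $$\alpha_i+\beta_i\,|\Gamma(x)\cap\Gamma(y)\cap\Gamma_{i-1}(z)|+\gamma_i\,|\Gamma_{i-1}(x)\cap\Gamma_{i-1}(y)\cap\Gamma(z)|=0.$$ Then $\gamma_i\neq0$.
   Context: $\Gamma$ is finite, connected, undirected, without loops or multiple edges; $\partial$ is path-length distance, $\Gamma_i(z)$ the set of vertices at distance $i$ from $z$, $\Gamma(z)=\Gamma_1(z)$. For the fixed $x$, $E_i^*$ is the diagonal matrix in $\mathrm{Mat}_X(\mathbb{C})$ with $(z,z)$-entry $1$ if $\partial(x,z)=i$ and $0$ otherwise; $T=T(x)$ is generated by the adjacency matrix $A$ and $E_0^*,\dots,E_D^*$. $T$-modules are $T$-invariant subspaces of $\mathbb{C}^X$; irreducible and isomorphic as usual; endpoint of irreducible $W$ is $\min\{i:E_i^*W\ne0\}$; $W$ is thin if $\dim E_i^*W\le1$ for all $i$. *)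

theory Defs
  imports "HOL-Analysis.Analysis"
begin

text \<open>
  A graph is given by its adjacency relation on a finite type, whose elements are the vertices
  (X is the whole type). Mat_X(C) is \<^typ>\<open>complex^'v^'v\<close>, acting on the complex vector space
  \<^typ>\<open>complex^'v\<close>; the operations \<open>vec.subspace\<close> and \<open>vec.dim\<close> are those over the complex
  field, whereas the unqualified \<open>subspace\<close> and \<open>dim\<close> would be real.
\<close>

definition simple_graph :: "('v \<Rightarrow> 'v \<Rightarrow> bool) \<Rightarrow> bool" where
  "simple_graph E \<longleftrightarrow> symp E \<and> irreflp E"

definition connected_graph :: "('v \<Rightarrow> 'v \<Rightarrow> bool) \<Rightarrow> bool" where
  "connected_graph E \<longleftrightarrow> (\<forall>u v. E\<^sup>*\<^sup>* u v)"

text \<open>\<open>(E ^^ n) u v\<close> says that there is a walk of length \<open>n\<close> from \<open>u\<close> to \<open>v\<close>; a shortest walk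
  is a path. The value is unspecified if \<open>v\<close> is not reachable from \<open>u\<close>.\<close>

definition gdist :: "('v \<Rightarrow> 'v \<Rightarrow> bool) \<Rightarrow> 'v \<Rightarrow> 'v \<Rightarrow> nat" where
  "gdist E u v = (LEAST n. (E ^^ n) u v)"

definition diam :: "('v::finite \<Rightarrow> 'v \<Rightarrow> bool) \<Rightarrow> nat" where
  "diam E = Max {gdist E u v | u v. True}"

definition sphere_at :: "('v \<Rightarrow> 'v \<Rightarrow> bool) \<Rightarrow> nat \<Rightarrow> 'v \<Rightarrow> 'v set" where
  "sphere_at E i z = {w. gdist E z w = i}"

definition bipartite_graph :: "('v \<Rightarrow> 'v \<Rightarrow> bool) \<Rightarrow> bool" where
  "bipartite_graph E \<longleftrightarrow> (\<exists>S. \<forall>u v. E u v \<longrightarrow> (u \<in> S \<longleftrightarrow> v \<notin> S))"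

definition has_valency :: "('v::finite \<Rightarrow> 'v \<Rightarrow> bool) \<Rightarrow> nat \<Rightarrow> bool" where
  "has_valency E k \<longleftrightarrow> (\<forall>v. card (sphere_at E 1 v) = k)"

definition distance_regular :: "('v::finite \<Rightarrow> 'v \<Rightarrow> bool) \<Rightarrow> bool" where
  "distance_regular E \<longleftrightarrow> simple_graph E \<and> connected_graph E \<and>
    (\<forall>h\<le>diam E. \<forall>i\<le>diam E. \<forall>j\<le>diam E. \<exists>p. \<forall>u v. gdist E u v = h \<longrightarrow>
       card (sphere_at E i u \<inter> sphere_at E j v) = p)"

definition adj_matrix :: "('v::finite \<Rightarrow> 'v \<Rightarrow> bool) \<Rightarrow> complex^'v^'v" where
  "adj_matrix E = (\<chi> y z. if E y z then 1 else 0)"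

definition dual_idem :: "('v::finite \<Rightarrow> 'v \<Rightarrow> bool) \<Rightarrow> 'v \<Rightarrow> nat \<Rightarrow> complex^'v^'v" where
  "dual_idem E x i = (\<chi> y z. if y = z \<and> gdist E x z = i then 1 else 0)"

text \<open>The unital complex subalgebra generated by a set of matrices.\<close>

inductive_set matrix_algebra :: "(complex^'v^'v) set \<Rightarrow> (complex^'v::finite^'v) set"
  for S :: "(complex^'v^'v) set" where
  gen: "M \<in> S \<Longrightarrow> M \<in> matrix_algebra S"
| one: "mat 1 \<in> matrix_algebra S"
| add: "M \<in> matrix_algebra S \<Longrightarrow> N \<in> matrix_algebra S \<Longrightarrow> M + N \<in> matrix_algebra S"
| scale: "M \<in> matrix_algebra S \<Longrightarrow> (\<chi> y z. c * M $ y $ z) \<in> matrix_algebra S"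
| mult: "M \<in> matrix_algebra S \<Longrightarrow> N \<in> matrix_algebra S \<Longrightarrow> M ** N \<in> matrix_algebra S"

definition terwilliger_algebra ::
    "('v::finite \<Rightarrow> 'v \<Rightarrow> bool) \<Rightarrow> 'v \<Rightarrow> (complex^'v^'v) set" where
  "terwilliger_algebra E x =
     matrix_algebra (insert (adj_matrix E) (dual_idem E x ` {..diam E}))"

definition T_module ::
    "('v::finite \<Rightarrow> 'v \<Rightarrow> bool) \<Rightarrow> 'v \<Rightarrow> (complex^'v) set \<Rightarrow> bool" where
  "T_module E x W \<longleftrightarrow>
     vec.subspace W \<and> (\<forall>B\<in>terwilliger_algebra E x. \<forall>w\<in>W. B *v w \<in> W)"

definition irreducible_T_module ::
    "('v::finite \<Rightarrow> 'v \<Rightarrow> bool) \<Rightarrow> 'v \<Rightarrow> (complex^'v) set \<Rightarrow> bool" where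
  "irreducible_T_module E x W \<longleftrightarrow> T_module E x W \<and> W \<noteq> {0} \<and>
     (\<forall>U. T_module E x U \<and> U \<subseteq> W \<longrightarrow> U = {0} \<or> U = W)"

definition isomorphic_T_modules ::
    "('v::finite \<Rightarrow> 'v \<Rightarrow> bool) \<Rightarrow> 'v \<Rightarrow> (complex^'v) set \<Rightarrow> (complex^'v) set \<Rightarrow> bool" where
  "isomorphic_T_modules E x W W' \<longleftrightarrow> (\<exists>f. bij_betw f W W' \<and>
     (\<forall>u\<in>W. \<forall>w\<in>W. f (u + w) = f u + f w) \<and>
     (\<forall>c. \<forall>w\<in>W. f (c *s w) = c *s f w) \<and>
     (\<forall>B\<in>terwilliger_algebra E x. \<forall>w\<in>W. f (B *v w) = B *v f w))"

definition endpoint ::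
    "('v::finite \<Rightarrow> 'v \<Rightarrow> bool) \<Rightarrow> 'v \<Rightarrow> (complex^'v) set \<Rightarrow> nat" where
  "endpoint E x W = (LEAST i. (\<lambda>w. dual_idem E x i *v w) ` W \<noteq> {0})"

definition thin ::
    "('v::finite \<Rightarrow> 'v \<Rightarrow> bool) \<Rightarrow> 'v \<Rightarrow> (complex^'v) set \<Rightarrow> bool" where
  "thin E x W \<longleftrightarrow> (\<forall>i\<le>diam E. vec.dim ((\<lambda>w. dual_idem E x i *v w) ` W) \<le> 1)"

definition two_thin_endpoint_2 :: "('v::finite \<Rightarrow> 'v \<Rightarrow> bool) \<Rightarrow> 'v \<Rightarrow> bool" where
  "two_thin_endpoint_2 E x \<longleftrightarrow> (\<exists>U V.
     irreducible_T_module E x U \<and> endpoint E x U = 2 \<and> thin E x U \<and>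
     irreducible_T_module E x V \<and> endpoint E x V = 2 \<and> thin E x V \<and>
     \<not> isomorphic_T_modules E x U V \<and>
     (\<forall>W. irreducible_T_module E x W \<and> endpoint E x W = 2 \<longrightarrow>
        isomorphic_T_modules E x W U \<or> isomorphic_T_modules E x W V))"

end

theory Submission
  imports Defs
begin

text \<open>
  Suppose \<open>\<gamma> = 0\<close>. Some pair \<open>y, z\<close> satisfies the distance conditions, so \<open>\<beta> \<noteq> 0\<close> and
  \<open>|\<Gamma>(x) \<inter> \<Gamma>(y) \<inter> \<Gamma>\<^bsub>i-1\<^esub>(z)|\<close> is a constant \<open>q\<close>. Let \<open>W\<close> be thin irreducible of endpoint 2,
  \<open>v \<in> E\<^sub>2\<^sup>*W\<close> nonzero and \<open>u\<^sub>n = E\<^bsub>n+2\<^esub>\<^sup>* A\<^sub>n v\<close>. By thinness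
  \<open>E\<^bsub>n+2\<^esub>\<^sup>* A\<^bsub>n+4\<^esub> v = \<tau>\<^sub>n u\<^sub>n\<close>, where a recursion makes all \<open>\<tau>\<^sub>n\<close> functions of the single real
  number \<open>t = \<tau>\<^sub>0\<close>; moreover \<open>A\<close> acts on the spanning family \<open>u\<^sub>n\<close> of \<open>W\<close> by coefficients depending
  only on \<open>t\<close>, so \<open>t\<close> determines \<open>W\<close> up to isomorphism. Summing the constancy of \<open>q\<close> against \<open>v\<close> and
  using \<open>E\<^sub>1\<^sup>*W = 0\<close> gives \<open>c\<^sub>2 - q = q \<tau>\<^bsub>i-2\<^esub>\<close>, hence \<open>\<tau>\<^bsub>i-2\<^esub> \<ge> 0\<close> takes the same value on all
  such modules. But \<open>\<tau>\<^bsub>i-2\<^esub>\<close> has the sign of \<open>t\<close>, and for \<open>t > 0\<close> it is strictly monotone in \<open>t\<close>, so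
  there is only one isomorphism class.
\<close>

section \<open>Distances in a bipartite distance-regular graph\<close>

locale bipartite_drg =
  fixes E :: "'v::finite \<Rightarrow> 'v \<Rightarrow> bool" and k :: nat
  assumes drg: "distance_regular E" and bip: "bipartite_graph E"
    and diam_ge: "diam E \<ge> 4" and val: "has_valency E k"
begin

abbreviation "d \<equiv> gdist E"
abbreviation "D \<equiv> diam E"

lemma E_sym: "E u v \<Longrightarrow> E v u" and E_irrefl: "\<not> E u u"
  using drg unfolding distance_regular_def simple_graph_def symp_def irreflp_def by blast+

lemma walk_gdist: "(E ^^ d u v) u v"
proof -
  have "E\<^sup>*\<^sup>* u v" using drg unfolding distance_regular_def connected_graph_def by blast
  then obtain n where "(E ^^ n) u v" using rtranclp_power by metis
  then show ?thesis unfolding gdist_def by (rule LeastI)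
qed

lemma gdist_le: "(E ^^ n) u v \<Longrightarrow> d u v \<le> n"
  unfolding gdist_def by (rule Least_le)

lemma walk_sym: "(E ^^ n) u v \<Longrightarrow> (E ^^ n) v u"
proof (induction n arbitrary: v)
  case (Suc n)
  then obtain w where "(E ^^ n) u w" "E w v" by (auto elim: relpowp_Suc_E)
  then show ?case using Suc.IH[of w] E_sym[of w v] relpowp_Suc_I2[of E v w n u] by blast
qed auto

lemma gdist_sym: "d u v = d v u"
  using gdist_le walk_sym walk_gdist by (meson le_antisym)

lemma gdist_triangle: "d u w \<le> d u v + d v w"
proof -
  have "(E ^^ (d u v + d v w)) u w"
    unfolding relpowp_add using walk_gdist by blast
  then show ?thesis by (rule gdist_le)
qed

lemma gdist_0_iff [simp]: "d u v = 0 \<longleftrightarrow> u = v"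
  using walk_gdist[of u v] gdist_le[of 0 u v] by (metis le_zero_eq relpowp.simps(1))

lemma gdist_1_iff: "d u v = 1 \<longleftrightarrow> E u v"
proof
  assume "d u v = 1" then show "E u v" using walk_gdist[of u v] by (simp add: OO_def)
next
  assume "E u v"
  then have "d u v \<le> 1" by (intro gdist_le) (simp add: OO_def)
  moreover have "d u v \<noteq> 0" using \<open>E u v\<close> E_irrefl by (metis gdist_0_iff)
  ultimately show "d u v = 1" by linarith
qed

text \<open>A walk changes side of the bipartition at every step, so the parity of a distance tells
  whether its ends lie on the same side.\<close>

lemma gdist_parity: "even (d u v + d v w + d u w)"
proof -
  obtain S where S: "\<And>u v. E u v \<Longrightarrow> (u \<in> S \<longleftrightarrow> v \<notin> S)"
    using bip unfolding bipartite_graph_def by blast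
  have "(E ^^ n) u v \<Longrightarrow> even n \<longleftrightarrow> (u \<in> S \<longleftrightarrow> v \<in> S)" for n u v
  proof (induction n arbitrary: v)
    case (Suc n)
    then obtain w where "(E ^^ n) u w" "E w v" by (auto elim: relpowp_Suc_E)
    then show ?case using Suc.IH[of w] S[of w v] by auto
  qed auto
  then have "even (d u v) \<longleftrightarrow> (u \<in> S \<longleftrightarrow> v \<in> S)" for u v using walk_gdist by blast
  then show ?thesis by auto
qed

lemma gdist_neighbour:
  assumes "d u v = 1"
  shows "d z v = d z u + 1 \<or> d z u = d z v + 1"
proof -
  have "d z v \<le> d z u + 1" "d z u \<le> d z v + 1"
    using gdist_triangle[of z v u] gdist_triangle[of z u v] assms gdist_sym[of u v] by auto
  moreover have "d z v \<noteq> d z u" using gdist_parity[of z u v] assms by auto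
  ultimately show ?thesis by linarith
qed

lemma gdist_Suc_predecessor:
  assumes "d u v = Suc n"
  obtains w where "d u w = n" "d w v = 1"
proof -
  obtain w where w: "(E ^^ n) u w" "E w v"
    using walk_gdist[of u v] assms by (auto elim: relpowp_Suc_E)
  have "d w v = 1" using w gdist_1_iff by simp
  moreover have "d u w = n"
    using gdist_le[OF w(1)] gdist_triangle[of u v w] assms \<open>d w v = 1\<close> by linarith
  ultimately show thesis using that by blast
qed

lemma gdist_le_diam: "d u v \<le> D"
proof -
  have "finite {d u v | u v. True}"
    using finite_surj[of "UNIV :: ('v \<times> 'v) set" "{d u v | u v. True}" "\<lambda>(u, v). d u v"] by auto
  then show ?thesis unfolding diam_def by (intro Max_ge) auto
qed

text \<open>The maximum is attained at some pair \<open>a\<close>, \<open>b\<close>;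
  distance-regularity with \<open>h = 0\<close> makes the size of spheres of radius \<open>D\<close>
  independent of the centre.\<close>

lemma sphere_diam_nonempty: "\<exists>z. d u z = D"
proof -
  have fin: "finite {d u v | u v. True}"
    using finite_surj[of "UNIV :: ('v \<times> 'v) set" "{d u v | u v. True}" "\<lambda>(u, v). d u v"] by auto
  have "D \<in> {d u v | u v. True}" unfolding diam_def by (rule Max_in[OF fin]) auto
  then obtain a b where ab: "d a b = D" by auto
  have "\<exists>p. \<forall>u v. d u v = 0 \<longrightarrow> card (sphere_at E D u \<inter> sphere_at E D v) = p"
    using drg unfolding distance_regular_def by blast
  then have "card (sphere_at E D u) = card (sphere_at E D a)" by (metis gdist_0_iff inf.idem)
  moreover have "card (sphere_at E D a) \<noteq> 0"
    using ab unfolding sphere_at_def by auto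
  ultimately have "sphere_at E D u \<noteq> {}" by auto
  then show ?thesis unfolding sphere_at_def by auto
qed

lemma sphere_nonempty: "n \<le> D \<Longrightarrow> \<exists>z. d u z = n"
proof (induction n rule: inc_induct)
  case base show ?case by (rule sphere_diam_nonempty)
next
  case (step n)
  then show ?case using gdist_Suc_predecessor by metis
qed

section \<open>Intersection numbers\<close>

text \<open>Beyond the diameter \<open>c\<close> is set to the valency, so that \<open>c (Suc n) > 0\<close> always holds.\<close>

definition c :: "nat \<Rightarrow> nat" where
  "c n = (if n = 0 then 0 else if n > D then k else
    (SOME p. \<forall>u v. d u v = n \<longrightarrow> card (sphere_at E (n - 1) u \<inter> sphere_at E 1 v) = p))"

definition b :: "nat \<Rightarrow> nat" where
  "b n = k - c n"

lemma card_neighbours: "card {w. d y w = 1} = k"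
  using val unfolding has_valency_def sphere_at_def by simp

lemma intersection_number:
  assumes "h \<le> D" "i \<le> D" "j \<le> D"
  shows "\<exists>p. \<forall>u v. d u v = h \<longrightarrow> card (sphere_at E i u \<inter> sphere_at E j v) = p"
proof -
  have "\<forall>h\<le>D. \<forall>i\<le>D. \<forall>j\<le>D. \<exists>p. \<forall>u v. d u v = h \<longrightarrow>
       card (sphere_at E i u \<inter> sphere_at E j v) = p"
    using drg unfolding distance_regular_def by (elim conjE)
  from this[rule_format, OF assms] show ?thesis .
qed

lemma card_c:
  assumes "d z y = Suc n" shows "card {w. d y w = 1 \<and> d z w = n} = c (Suc n)"
proof -
  have le: "Suc n \<le> D" using gdist_le_diam[of z y] assms by simp
  moreover have "n \<le> D" "1 \<le> D" using le diam_ge by linarith+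
  ultimately have "\<exists>p. \<forall>u v. d u v = Suc n \<longrightarrow> card (sphere_at E n u \<inter> sphere_at E 1 v) = p"
    by (rule intersection_number)
  from someI_ex[OF this] assms have "card (sphere_at E n z \<inter> sphere_at E 1 y) =
      (SOME p. \<forall>u v. d u v = Suc n \<longrightarrow> card (sphere_at E n u \<inter> sphere_at E 1 v) = p)"
    by blast
  also have "\<dots> = c (Suc n)"
    unfolding c_def using le by (simp only: not_less[symmetric] if_False nat.distinct diff_Suc_1)
  also have "sphere_at E n z \<inter> sphere_at E 1 y = {w. d y w = 1 \<and> d z w = n}"
    unfolding sphere_at_def by blast
  finally show ?thesis .
qed

lemma card_b:
  assumes "d z y = n" shows "card {w. d y w = 1 \<and> d z w = Suc n} + c n = k"
proof (cases n)
  case 0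
  then have "z = y" using assms by simp
  then show ?thesis using 0 card_neighbours[of y] by (simp add: c_def)
next
  case (Suc m)
  have "{w. d y w = 1} = {w. d y w = 1 \<and> d z w = Suc n} \<union> {w. d y w = 1 \<and> d z w = m}"
    using gdist_neighbour[of y _ z] assms Suc by fastforce
  moreover have "{w. d y w = 1 \<and> d z w = Suc n} \<inter> {w. d y w = 1 \<and> d z w = m} = {}"
    using Suc by auto
  ultimately show ?thesis
    using card_c[of z y m] card_neighbours[of y] assms Suc
      card_Un_disjoint[of "{w. d y w = 1 \<and> d z w = Suc n}" "{w. d y w = 1 \<and> d z w = m}"] by simp
qed

text \<open>The subtraction in \<open>b\<close> is truncated, so this amounts to
  \<open>c n \<le> k\<close>: by counting neighbours up to the diameter, and by the convention
  \<open>c n = k\<close> beyond it.\<close>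

lemma c_add_b: "c n + b n = k"
proof (cases "n \<le> D")
  case True
  then obtain z where "d undefined z = n" using sphere_nonempty by blast
  from card_b[OF this] show ?thesis unfolding b_def by simp
next
  case False
  then show ?thesis by (simp add: c_def b_def)
qed

lemma card_b': "d z y = n \<Longrightarrow> card {w. d y w = 1 \<and> d z w = Suc n} = b n"
  using card_b[of z y n] c_add_b[of n] by simp

lemma c_0 [simp]: "c 0 = 0" by (simp add: c_def)

lemma b_pos: assumes "n < D" shows "b n > 0"
proof -
  obtain u z where z: "d u z = Suc n" using sphere_nonempty[of "Suc n"] assms by force
  then obtain w where w: "d u w = n" "d w z = 1" using gdist_Suc_predecessor by blast
  then have "{v. d w v = 1 \<and> d u v = Suc n} \<noteq> {}" using z by blast
  then have "card {v. d w v = 1 \<and> d u v = Suc n} > 0" unfolding card_gt_0_iff by simp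
  then show ?thesis unfolding card_b'[OF w(1)] .
qed

lemma c_pos: "c (Suc n) > 0"
proof (cases "Suc n \<le> D")
  case True
  then obtain u z where z: "d u z = Suc n" using sphere_nonempty[of "Suc n"] by force
  then obtain w where w: "d u w = n" "d w z = 1" using gdist_Suc_predecessor by blast
  then have "{v. d z v = 1 \<and> d u v = n} \<noteq> {}" using gdist_sym[of w z] by auto
  then have "card {v. d z v = 1 \<and> d u v = n} > 0" unfolding card_gt_0_iff by simp
  then show ?thesis unfolding card_c[OF z] .
next
  case False
  have "k > 0" using b_pos[of 0] diam_ge c_add_b[of 0] by linarith
  then show ?thesis using False by (simp add: c_def)
qed

text \<open>Move \<open>u\<close> one step towards \<open>y\<close> to reach \<open>u'\<close>: a
  neighbour of \<open>y\<close> that is one step closer to \<open>u'\<close> is also one step closer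
  to \<open>u\<close>.\<close>

lemma c_mono: assumes "Suc n \<le> D" shows "c n \<le> c (Suc n)"
proof (cases n)
  case (Suc m)
  obtain u y where uy: "d u y = Suc n" using sphere_nonempty[of "Suc n"] assms by force
  then have "d y u = Suc n" by (simp add: gdist_sym)
  then obtain u' where u': "d y u' = n" "d u' u = 1" using gdist_Suc_predecessor by blast
  have "{w. d y w = 1 \<and> d u' w = m} \<subseteq> {w. d y w = 1 \<and> d u w = n}"
  proof
    fix w assume "w \<in> {w. d y w = 1 \<and> d u' w = m}"
    then have "d y w = 1" "m = d u' w" by auto
    moreover have "d u w = n + 1 + 1 \<or> n + 1 = d u w + 1"
      using gdist_neighbour[of y w u] uy \<open>d y w = 1\<close> by auto
    moreover have "d u w \<le> 1 + d u' w" using gdist_triangle[of u w u'] u'(2) by (simp add: gdist_sym)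
    ultimately show "w \<in> {w. d y w = 1 \<and> d u w = n}" using Suc by auto
  qed
  then have "card {w. d y w = 1 \<and> d u' w = m} \<le> card {w. d y w = 1 \<and> d u w = n}"
    by (intro card_mono) auto
  then show ?thesis using card_c[of u' y m] card_c[OF uy] u'(1) Suc by (simp add: gdist_sym)
qed simp

lemma c_1: "c 1 = 1"
proof -
  obtain u y :: 'v where "d u y = Suc 0" using sphere_nonempty[of "Suc 0"] diam_ge by force
  moreover from this have "{w. d y w = 1 \<and> d u w = 0} = {u}" by (auto simp: gdist_sym)
  ultimately show ?thesis using card_c[of u y 0] by simp
qed

text \<open>Fix \<open>z\<close> at distance \<open>i\<close> from \<open>x\<close>, step from
  \<open>x\<close> to \<open>w\<close> and back to another \<open>y\<close> on the same sphere
  around \<open>z\<close>. A \<open>w\<close> nearer to \<open>z\<close> works if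
  \<open>b (i - 1) \<ge> 2\<close>; otherwise \<open>k \<ge> 3\<close> forces
  \<open>c (i - 1) \<ge> 2\<close>, hence \<open>c (i + 1) \<ge> 2\<close>, and a \<open>w\<close>
  farther from \<open>z\<close> works.\<close>

lemma exists_equidistant:
  assumes "k \<ge> 3" "1 \<le> i" "i < D"
  shows "\<exists>y z. d x y = 2 \<and> d x z = i \<and> d y z = i"
proof -
  obtain z where z: "d x z = i" using sphere_nonempty[of i x] less_imp_le[OF assms(3)] by blast
  then have zx: "d z x = i" by (simp add: gdist_sym)
  have two: ?thesis if w: "d x w = 1" and "Suc 0 < card {y. d w y = 1 \<and> d z y = i}" for w
  proof -
    have "\<not> {y. d w y = 1 \<and> d z y = i} \<subseteq> {x}"
      using that(2) card_mono[of "{x}" "{y. d w y = 1 \<and> d z y = i}"] by auto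
    then obtain y where y: "d w y = 1" "d z y = i" "y \<noteq> x" by blast
    have "d x y = 2"
    proof -
      have "d x y \<le> 2" "d x y \<noteq> 0" "d x y \<noteq> 1"
        using gdist_triangle[of x y w] gdist_parity[of x w y] w y by auto
      then show ?thesis by linarith
    qed
    with z y(2) show ?thesis using gdist_sym[of y z] by auto
  qed
  obtain i' where i': "i = Suc i'" using assms(2) by (cases i) auto
  show ?thesis
  proof (cases "b i' \<ge> 2")
    case True
    obtain w where w: "d z w = i'" "d w x = 1" using gdist_Suc_predecessor[of z x i'] zx i' by blast
    show ?thesis using two[of w] card_b'[OF w(1)] i' True w(2) by (simp add: gdist_sym)
  next
    case False
    have "c (Suc i) \<ge> 2"
    proof (rule ccontr)
      assume "\<not> ?thesis"
      then have "c i' < 2" using c_mono[of i'] c_mono[of i] assms(3) i' by simp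
      then show False using False c_add_b[of i'] assms(1) by linarith
    qed
    moreover have "card {w. d x w = 1 \<and> d z w = Suc i} = b i" using card_b'[OF zx] .
    then have "{w. d x w = 1 \<and> d z w = Suc i} \<noteq> {}" using b_pos[OF assms(3)] by (metis card.empty less_irrefl)
    then obtain w where "d x w = 1" "d z w = Suc i" by blast
    ultimately show ?thesis using two[of w] card_c[of z w i] by simp
  qed
qed


section \<open>The recursion for \<open>\<tau>\<close> and its monotonicity in
  \<open>t\<close>\<close>

text \<open>
  On a thin module of endpoint 2 with \<open>E\<^sub>2\<^sup>* A\<^sub>2 v = - (1 + t) v\<close> these are the ratios in
  \<open>E\<^bsub>n+2\<^esub>\<^sup>* A\<^bsub>n+4\<^esub> v = \<tau> t n \<cdot> u\<^sub>n\<close> and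
  \<open>E\<^bsub>n+2\<^esub>\<^sup>* A u\<^bsub>n+1\<^esub> = \<kappa> t n \<cdot> u\<^sub>n\<close>. At \<open>n = 0\<close> the truncated index
  \<open>n - 1\<close> is harmless because \<open>c 0 = 0\<close>.
\<close>

fun \<tau> :: "real \<Rightarrow> nat \<Rightarrow> real" where
  "\<tau> t 0 = t"
| "\<tau> t (Suc n) = b (n + 4) * \<tau> t n / (b (n + 2) - c (n + 2) * \<tau> t n + c n * \<tau> t (n - 1))"

definition \<kappa> :: "real \<Rightarrow> nat \<Rightarrow> real" where
  "\<kappa> t n = b (n + 2) - c (n + 2) * \<tau> t n + c n * \<tau> t (n - 1)"

lemma \<tau>_Suc: "\<tau> t (Suc n) = b (n + 4) * \<tau> t n / \<kappa> t n"
  by (simp add: \<kappa>_def)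

declare \<tau>.simps(2) [simp del]

lemma sgn_\<tau>:
  assumes "\<And>n. n < N \<Longrightarrow> \<kappa> t n > 0" "N + 4 \<le> D"
  shows "sgn (\<tau> t N) = sgn t"
  using assms
proof (induction N)
  case (Suc N)
  then have "sgn (real (b (N + 4))) = 1" "sgn (\<kappa> t N) = 1" using b_pos[of "N + 4"] by auto
  then show ?case using Suc by (simp add: \<tau>_Suc sgn_mult)
qed simp

text \<open>
  \<open>\<rho> p n = P\<^bsub>n+1\<^esub>(p) / P\<^sub>n(p)\<close>, where the polynomials \<open>P\<^sub>n\<close> with
  \<open>P\<^sub>n(A) = A\<^sub>n + A\<^bsub>n-2\<^esub> + \<dots>\<close> satisfy \<open>p P\<^sub>n = c\<^bsub>n+1\<^esub> P\<^bsub>n+1\<^esub> + b\<^bsub>n+1\<^esub> P\<^bsub>n-1\<^esub>\<close>.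
  For \<open>t > 0\<close> the nonlinear recursion for \<open>\<tau>\<close> is solved by \<open>P\<^sub>n(p) / P\<^bsub>n+2\<^esub>(p)\<close> up to a constant
  factor, where \<open>p\<^sup>2 = b\<^sub>2 + b\<^sub>2 b\<^sub>3 / t\<close>, and the ratios \<open>\<rho> p n\<close> visibly increase with \<open>p\<close>.
\<close>

fun \<rho> :: "real \<Rightarrow> nat \<Rightarrow> real" where
  "\<rho> p 0 = p"
| "\<rho> p (Suc n) = (p - b (n + 2) / \<rho> p n) / c (n + 2)"

text \<open>Both formulas go through one induction: positivity of \<open>\<kappa> t n\<close> yields
  that of \<open>\<rho> p (n + 2)\<close>, by which the next step divides.\<close>

lemma \<rho>_\<tau>:
  assumes t: "t > 0" and \<kappa>: "\<And>n. n < N \<Longrightarrow> \<kappa> t n > 0" and N: "N + 4 \<le> D"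
    and p: "p = sqrt (b 2 + b 2 * b 3 / t)" and n: "n \<le> N"
  shows "\<rho> p n > 0 \<and> \<rho> p (Suc n) > 0 \<and>
    \<tau> t n * (\<rho> p (Suc n) * \<rho> p n) = b (n + 2) * b (n + 3) / (c (n + 2) * c (n + 1)) \<and>
    \<kappa> t n = b (n + 2) * c (n + 3) * \<rho> p (n + 2) / (c (n + 1) * \<rho> p n)"
  using n
proof (induction n)
  case 0
  have pos: "b 2 > 0" "b 3 > 0" "c 2 > 0" "c 3 > 0"
    using b_pos[of 2] b_pos[of 3] N c_pos[of 1] c_pos[of 2] by (auto simp: numeral_2_eq_2 numeral_3_eq_3)
  then have p0: "p > 0" and p2: "p\<^sup>2 = b 2 + b 2 * b 3 / t" using t by (auto simp: p intro!: add_pos_pos)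
  \<comment> \<open>\<open>p\<close> is chosen so that
    \<open>p\<^sup>2 - b 2 = b 2 * b 3 / t\<close>; as \<open>c 1 = 1\<close>, this gives the
    product formula at \<open>n = 0\<close>.\<close>
  have "\<rho> p 1 = (p\<^sup>2 - b 2) / (c 2 * p)"
    using p0 pos by (simp add: field_simps power2_eq_square numeral_2_eq_2)
  also have "\<dots> = b 2 * b 3 / (t * c 2 * p)" unfolding p2 by simp
  finally have r1: "\<rho> p 1 = b 2 * b 3 / (t * c 2 * p)" .
  then have r1p: "\<rho> p 1 > 0" using pos t p0 by simp
  have r2: "c 3 * \<rho> p 2 = p - b 3 / \<rho> p 1"
    using pos by (simp add: numeral_2_eq_2 numeral_3_eq_3)
  have "\<kappa> t 0 = b 2 - c 2 * t" by (simp add: \<kappa>_def numeral_2_eq_2)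
  also have "\<dots> = b 2 * (p - b 3 / \<rho> p 1) / p"
    unfolding r1 using pos t p0 by (simp add: field_simps)
  also have "\<dots> = b 2 * c 3 * \<rho> p 2 / p" unfolding r2[symmetric] by simp
  finally have k0: "\<kappa> t 0 = b 2 * c 3 * \<rho> p 2 / p" .
  have "t * (\<rho> p 1 * p) = b 2 * b 3 / (c 2 * c 1)"
    unfolding r1 c_1 using pos t p0 by simp
  with p0 r1p k0 c_1 show ?case
    by (simp add: numeral_2_eq_2 numeral_3_eq_3 del: \<rho>.simps(2))
next
  case (Suc n)
  define r0 r1 r2 r3 where r_defs: "r0 = \<rho> p n" "r1 = \<rho> p (n + 1)" "r2 = \<rho> p (n + 2)" "r3 = \<rho> p (n + 3)"
  have IH: "r0 > 0" "r1 > 0" "\<tau> t n * (r1 * r0) = b (n + 2) * b (n + 3) / (c (n + 2) * c (n + 1))"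
    "\<kappa> t n = b (n + 2) * c (n + 3) * r2 / (c (n + 1) * r0)"
    using Suc by (auto simp: r_defs)
  have pos: "real (b (n + 2)) > 0" "real (b (n + 3)) > 0" "real (c (n + 1)) > 0"
    "real (c (n + 2)) > 0" "real (c (n + 3)) > 0" "real (c (n + 4)) > 0"
    using b_pos[of "n + 2"] b_pos[of "n + 3"] N Suc.prems
      c_pos[of n] c_pos[of "n + 1"] c_pos[of "n + 2"] c_pos[of "n + 3"]
    by (auto simp: eval_nat_numeral)
  have "\<kappa> t n > 0" using \<kappa> Suc.prems by simp
  have "r2 > 0"
  proof (rule ccontr)
    assume "\<not> r2 > 0"
    then have "\<kappa> t n \<le> 0"
      unfolding IH(4) using IH(1) pos by (intro divide_nonpos_pos mult_nonneg_nonpos) auto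
    with \<open>\<kappa> t n > 0\<close> show False by simp
  qed
  \<comment> \<open>The recursion for \<open>\<rho>\<close> solved for \<open>p\<close> at two
    indices. The first collects two terms of \<open>\<kappa> t (Suc n)\<close> into
    \<open>p\<close>, the second turns the remaining difference into a multiple of
    \<open>r3\<close>.\<close>
  have ps: "p = c (n + 2) * r1 + b (n + 2) / r0" "p = c (n + 4) * r3 + b (n + 4) / r2"
    using pos by (simp_all add: r_defs eval_nat_numeral)
  have "\<tau> t (Suc n) * (r2 * r1) = b (n + 4) * \<tau> t n * (r2 * r1) / \<kappa> t n"
    by (simp add: \<tau>_Suc)
  also have "\<dots> = b (n + 4) * (\<tau> t n * (r1 * r0)) * c (n + 1) / (b (n + 2) * c (n + 3))"
    unfolding IH(4) using pos \<open>r2 > 0\<close> IH(1,2) by (simp add: field_simps)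
  also have "\<dots> = b (n + 3) * b (n + 4) / (c (n + 3) * c (n + 2))"
    unfolding IH(3) using pos by (simp add: field_simps)
  finally have tS: "\<tau> t (Suc n) * (r2 * r1) = b (n + 3) * b (n + 4) / (c (n + 3) * c (n + 2))" .
  have "\<kappa> t (Suc n) = b (n + 3) - c (n + 3) * \<tau> t (Suc n) + c (n + 1) * \<tau> t n"
    by (simp add: \<kappa>_def eval_nat_numeral)
  also have "\<tau> t (Suc n) = b (n + 3) * b (n + 4) / (c (n + 3) * c (n + 2) * (r2 * r1))"
    using tS \<open>r2 > 0\<close> IH(1,2) pos by (simp add: field_simps)
  also have "\<tau> t n = b (n + 2) * b (n + 3) / (c (n + 2) * c (n + 1) * (r1 * r0))"
    using IH(1-3) pos by (simp add: field_simps)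
  also have "b (n + 3) - c (n + 3) * (b (n + 3) * b (n + 4) / (c (n + 3) * c (n + 2) * (r2 * r1)))
      + c (n + 1) * (b (n + 2) * b (n + 3) / (c (n + 2) * c (n + 1) * (r1 * r0)))
    = b (n + 3) / (c (n + 2) * r1) * ((c (n + 2) * r1 + b (n + 2) / r0) - b (n + 4) / r2)"
    using \<open>r2 > 0\<close> IH(1,2) pos by (simp add: field_simps)
  also have "\<dots> = b (n + 3) / (c (n + 2) * r1) * (c (n + 4) * r3)"
    using ps by simp
  finally have "\<kappa> t (Suc n) = b (n + 3) * c (n + 4) * r3 / (c (n + 2) * r1)" by simp
  with tS IH(2) \<open>r2 > 0\<close> show ?case by (simp add: r_defs eval_nat_numeral)
qed

text \<open>A larger \<open>t\<close> gives a smaller \<open>p\<close> and so smaller ratios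
  \<open>\<rho>\<close>, while \<open>\<tau>\<close> times the product of two consecutive ratios
  does not depend on \<open>t\<close>.\<close>

lemma \<tau>_strict_mono:
  assumes t: "0 < t" "t < t'" and \<kappa>: "\<And>n. n < N \<Longrightarrow> \<kappa> t n > 0" "\<And>n. n < N \<Longrightarrow> \<kappa> t' n > 0"
    and N: "N + 4 \<le> D"
  shows "\<tau> t N < \<tau> t' N"
proof -
  define p p' where p: "p = sqrt (b 2 + b 2 * b 3 / t)" and p': "p' = sqrt (b 2 + b 2 * b 3 / t')"
  have pos: "b n > 0" if "n < N + 4" for n using that N b_pos by simp
  have "p' < p" unfolding p p' using pos[of 2] pos[of 3] t
    by (simp add: divide_strict_left_mono)
  note R = \<rho>_\<tau>[OF t(1) \<kappa>(1) N p] and R' = \<rho>_\<tau>[OF order.strict_trans[OF t] \<kappa>(2) N p']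
  have less: "\<rho> p' n < \<rho> p n" if "n \<le> Suc N" for n
    using that
  proof (induction n)
    case (Suc n)
    then have "0 < \<rho> p' n" "\<rho> p' n < \<rho> p n" using R'[of n] by auto
    then have "b (n + 2) / \<rho> p n \<le> b (n + 2) / \<rho> p' n" by (simp add: frac_le)
    then show ?case using \<open>p' < p\<close> c_pos[of "Suc n"] by (simp add: divide_strict_right_mono)
  qed (use \<open>p' < p\<close> in simp)
  let ?B = "b (N + 2) * b (N + 3) / (c (N + 2) * c (N + 1))"
  have "\<tau> t N * (\<rho> p (Suc N) * \<rho> p N) = ?B" "\<tau> t' N * (\<rho> p' (Suc N) * \<rho> p' N) = ?B"
    using R[of N] R'[of N] by auto
  moreover have "\<rho> p' (Suc N) * \<rho> p' N < \<rho> p (Suc N) * \<rho> p N"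
    using less[of N] less[of "Suc N"] R[of N] R'[of N] by (intro mult_strict_mono) auto
  moreover have "\<rho> p' (Suc N) * \<rho> p' N > 0" "\<tau> t' N > 0"
    using R'[of N] sgn_\<tau>[of N t'] \<kappa>(2) N t
    by (auto simp: sgn_if split: if_splits simp del: \<rho>.simps)
  ultimately have "\<tau> t N * (\<rho> p (Suc N) * \<rho> p N) < \<tau> t' N * (\<rho> p (Suc N) * \<rho> p N)"
    by (metis mult_strict_left_mono)
  moreover have "\<rho> p (Suc N) * \<rho> p N > 0" using R[of N] by (simp del: \<rho>.simps)
  ultimately show ?thesis by (simp only: mult_less_cancel_right_pos)
qed


section \<open>Distance matrices and layer projections as operators on vectors\<close>

definition dist_op :: "nat \<Rightarrow> complex^'v \<Rightarrow> complex^'v" where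
  "dist_op n v = (\<chi> y. \<Sum>z\<in>UNIV. if d y z = n then v $ z else 0)"

abbreviation "A_op \<equiv> dist_op 1"

definition proj :: "'v \<Rightarrow> nat \<Rightarrow> complex^'v \<Rightarrow> complex^'v" where
  "proj x j v = (\<chi> y. if d x y = j then v $ y else 0)"

lemma adj_matrix_mult: "adj_matrix E *v v = A_op v"
  by (simp add: adj_matrix_def dist_op_def matrix_vector_mult_def vec_eq_iff gdist_1_iff[unfolded One_nat_def]
      if_distrib[of "\<lambda>c. c * _"] cong: if_cong)

lemma dist_op_nth: "dist_op n v $ y = (\<Sum>z\<in>UNIV. if d y z = n then v $ z else 0)"
  by (simp add: dist_op_def)

lemma proj_nth: "proj x j v $ y = (if d x y = j then v $ y else 0)"
  by (simp add: proj_def)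

lemma dual_idem_mult: "dual_idem E x j *v v = proj x j v"
proof -
  have "(\<Sum>z\<in>UNIV. (if y = z \<and> d x z = j then 1 else 0) * v $ z) = (if d x y = j then v $ y else 0)" for y
  proof -
    have "(\<Sum>z\<in>UNIV. (if y = z \<and> d x z = j then 1 else 0) * v $ z)
        = (\<Sum>z\<in>UNIV. if y = z then (if d x y = j then v $ y else 0) else 0)"
      by (intro sum.cong) auto
    then show ?thesis by simp
  qed
  moreover have "(if y = z \<and> d x y = j then 1 else 0) = (if y = z \<and> d x z = j then 1 else (0 :: complex))" for y z
    by auto
  ultimately show ?thesis by (simp add: dual_idem_def proj_nth matrix_vector_mult_def vec_eq_iff)
qed

lemma dist_op_add: "dist_op n (v + w) = dist_op n v + dist_op n w"
  and dist_op_scale: "dist_op n (a *s v) = a *s dist_op n v"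
  and dist_op_diff: "dist_op n (v - w) = dist_op n v - dist_op n w"
  and dist_op_minus: "dist_op n (- v) = - dist_op n v"
  and dist_op_0 [simp]: "dist_op n 0 = 0"
  by (auto simp: dist_op_def vec_eq_iff sum_distrib_left simp flip: sum.distrib sum_subtractf sum_negf intro!: sum.cong sum.neutral)

lemma proj_add: "proj x j (v + w) = proj x j v + proj x j w"
  and proj_scale: "proj x j (a *s v) = a *s proj x j v"
  and proj_diff: "proj x j (v - w) = proj x j v - proj x j w"
  and proj_minus: "proj x j (- v) = - proj x j v"
  and proj_0 [simp]: "proj x j 0 = 0"
  and proj_proj: "proj x j (proj x l v) = (if j = l then proj x j v else 0)"
  by (auto simp: proj_def vec_eq_iff)

lemma dist_op_0_eq: "dist_op 0 v = v"
  by (simp add: dist_op_def vec_eq_iff)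

text \<open>The \<open>(y, z)\<close> entry of the product counts neighbours of \<open>y\<close> at
  distance \<open>n\<close> from \<open>z\<close>. By bipartiteness these exist only if
  \<open>d y z\<close> is \<open>n + 1\<close> or \<open>n - 1\<close>, so there is no middle
  term.\<close>

lemma A_dist_op:
  "A_op (dist_op n v) = of_nat (c (Suc n)) *s dist_op (Suc n) v +
     (if n = 0 then 0 else of_nat (b (n - 1)) *s dist_op (n - 1) v)"
proof -
  have cnt: "of_nat (card {w. d y w = 1 \<and> d w z = n}) * a =
      of_nat (c (Suc n)) * (if d y z = Suc n then a else 0) +
      (if n = 0 then 0 else of_nat (b (n - 1)) * (if d y z = n - 1 then a else 0))" for y z and a :: complex
  proof -
    have sym: "{w. d y w = 1 \<and> d w z = n} = {w. d y w = 1 \<and> d z w = n}" by (auto simp: gdist_sym)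
    consider "d y z = Suc n" | m where "n = Suc m" "d y z = m"
      | "d y z \<noteq> Suc n" "n = 0 \<or> d y z \<noteq> n - 1" by (cases n) auto
    then show ?thesis
    proof cases
      case 1 then show ?thesis using card_c[of z y n] unfolding sym by (auto simp: gdist_sym)
    next
      case 2 then show ?thesis using card_b'[of z y m] unfolding sym by (auto simp: gdist_sym)
    next
      case 3
      then have "{w. d y w = 1 \<and> d w z = n} = {}"
        unfolding sym using gdist_neighbour[of y _ z] by (fastforce simp: gdist_sym)
      with 3 show ?thesis by auto
    qed
  qed
  have "(\<Sum>w\<in>UNIV. if d y w = 1 then \<Sum>z\<in>UNIV. if d w z = n then v $ z else 0 else 0)
     = (\<Sum>z\<in>UNIV. of_nat (card {w. d y w = 1 \<and> d w z = n}) * v $ z)" for y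
  proof -
    have "(\<Sum>w\<in>UNIV. if d y w = 1 then \<Sum>z\<in>UNIV. if d w z = n then v $ z else 0 else 0)
      = (\<Sum>w\<in>UNIV. \<Sum>z\<in>UNIV. if d y w = 1 \<and> d w z = n then v $ z else 0)"
      by (intro sum.cong) auto
    also have "\<dots> = (\<Sum>z\<in>UNIV. \<Sum>w\<in>UNIV. if d y w = 1 \<and> d w z = n then v $ z else 0)"
      by (rule sum.swap)
    also have "\<dots> = (\<Sum>z\<in>UNIV. of_nat (card {w. d y w = 1 \<and> d w z = n}) * v $ z)"
      by (simp add: sum.If_cases)
    finally show ?thesis .
  qed
  then have "A_op (dist_op n v) $ y = (\<Sum>z\<in>UNIV. of_nat (card {w. d y w = 1 \<and> d w z = n}) * v $ z)" for y
    by (simp only: dist_op_nth)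
  then show ?thesis
    unfolding vec_eq_iff cnt by (simp add: dist_op_nth sum.distrib sum_distrib_left)
qed

lemma proj_A_op:
  "proj x (Suc j) (A_op v) = proj x (Suc j) (A_op (proj x (Suc (Suc j)) v)) + proj x (Suc j) (A_op (proj x j v))"
proof -
  have "(\<Sum>w\<in>UNIV. if d y w = 1 then v $ w else 0) =
      (\<Sum>w\<in>UNIV. if d y w = 1 then if d x w = Suc (Suc j) then v $ w else 0 else 0) +
      (\<Sum>w\<in>UNIV. if d y w = 1 then if d x w = j then v $ w else 0 else 0)" if "d x y = Suc j" for y
    unfolding sum.distrib[symmetric] using gdist_neighbour[of y _ x] that
    by (intro sum.cong) fastforce+
  then show ?thesis by (simp add: proj_nth dist_op_nth vec_eq_iff cong: if_cong)
qed

lemma proj_A_op_proj_eq_0: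
  assumes "j \<noteq> Suc l" "l \<noteq> Suc j" shows "proj x j (A_op (proj x l v)) = 0"
proof -
  have "(\<Sum>w\<in>UNIV. if d y w = 1 then if d x w = l then v $ w else 0 else 0) = 0" if "d x y = j" for y
    using gdist_neighbour[of y _ x] that assms by (intro sum.neutral) fastforce
  then show ?thesis by (simp add: proj_nth dist_op_nth vec_eq_iff cong: if_cong)
qed

text \<open>A nonzero entry would need vertices with \<open>d x y = j\<close>,
  \<open>d y z = n\<close>, \<open>d x z = h\<close>, against a triangle inequality or the parity of
  the sum.\<close>

lemma proj_dist_op_eq_0:
  assumes v: "proj x h v = v" and "\<not> (j \<le> n + h \<and> n \<le> j + h \<and> h \<le> n + j \<and> even (j + n + h))"
  shows "proj x j (dist_op n v) = 0"
proof -
  have "(if d y z = n then v $ z else 0) = 0" if "d x y = j" for y z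
  proof (cases "d x z = h")
    case True
    then have "d y z \<noteq> n"
      using assms(2) gdist_triangle[of x y z] gdist_triangle[of y z x] gdist_triangle[of x z y]
        gdist_parity[of x y z] that
      by (auto simp: gdist_sym[of y x] gdist_sym[of z y] add.commute)
    then show ?thesis by simp
  next
    case False
    have "v $ z = proj x h v $ z" using v by simp
    with False show ?thesis by (simp add: proj_nth)
  qed
  then show ?thesis by (auto simp: proj_def dist_op_def vec_eq_iff intro!: sum.neutral)
qed

lemma sum_proj: "(\<Sum>j\<le>D. proj x j v) = v"
proof -
  have "(\<Sum>j\<le>D. if d x y = j then v $ y else 0) = v $ y" for y
    using gdist_le_diam[of x y] by simp
  then show ?thesis by (simp add: vec_eq_iff proj_nth)
qed

lemma sum_dist_op: "(\<Sum>n\<le>D. dist_op n v) = (\<chi> y. \<Sum>z\<in>UNIV. v $ z)"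
proof -
  have "(\<Sum>n\<le>D. \<Sum>z\<in>UNIV. if d y z = n then v $ z else 0) = (\<Sum>z\<in>UNIV. v $ z)" for y
  proof -
    have "(\<Sum>n\<le>D. \<Sum>z\<in>UNIV. if d y z = n then v $ z else 0) = (\<Sum>z\<in>UNIV. \<Sum>n\<le>D. if d y z = n then v $ z else 0)"
      by (rule sum.swap)
    then show ?thesis using gdist_le_diam[of y] by simp
  qed
  then show ?thesis by (simp add: vec_eq_iff dist_op_def)
qed

text \<open>\<open>A_op\<close> and \<open>proj\<close> are self-adjoint for this form; squared
  norms will show that lowering coefficients are real and nonnegative.\<close>

definition cinner :: "complex^'v \<Rightarrow> complex^'v \<Rightarrow> complex" where
  "cinner v w = (\<Sum>y\<in>UNIV. v $ y * cnj (w $ y))"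

lemma cinner_self: "cinner v v = of_real (\<Sum>y\<in>UNIV. (cmod (v $ y))\<^sup>2)"
  by (simp add: cinner_def complex_norm_square[symmetric])

lemma cinner_self_pos: "v \<noteq> 0 \<Longrightarrow> (\<Sum>y\<in>UNIV. (cmod (v $ y))\<^sup>2) > 0"
proof -
  assume "v \<noteq> 0"
  then obtain y where "v $ y \<noteq> 0" by (auto simp: vec_eq_iff)
  then show ?thesis by (intro sum_pos2[of _ y]) auto
qed

lemma cinner_A_op: "cinner (A_op v) w = cinner v (A_op w)"
proof -
  have "cinner (A_op v) w = (\<Sum>y\<in>UNIV. \<Sum>z\<in>UNIV. if d y z = 1 then v $ z * cnj (w $ y) else 0)"
    by (simp add: cinner_def dist_op_def sum_distrib_right if_distrib[of "\<lambda>a. a * _"] cong: if_cong)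
  also have "\<dots> = (\<Sum>z\<in>UNIV. \<Sum>y\<in>UNIV. if d y z = 1 then v $ z * cnj (w $ y) else 0)"
    by (rule sum.swap)
  also have "\<dots> = cinner v (A_op w)"
    by (simp add: cinner_def dist_op_def sum_distrib_left if_distrib[of cnj] if_distrib[of "\<lambda>a. _ * a"]
        gdist_sym cong: if_cong)
  finally show ?thesis .
qed

lemma cinner_proj: "cinner (proj x j v) w = cinner v (proj x j w)"
  by (auto simp: cinner_def proj_nth intro!: sum.cong)

lemma cinner_scale: "cinner (a *s v) w = a * cinner v w" "cinner v (a *s w) = cnj a * cinner v w"
  by (simp_all add: cinner_def sum_distrib_left algebra_simps)


section \<open>Extreme layers of \<open>dist_op n v\<close> for a vector \<open>v\<close> in layer
  2\<close>

definition ascent :: "'v \<Rightarrow> complex^'v \<Rightarrow> nat \<Rightarrow> complex^'v" where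
  "ascent x v n = proj x (n + 2) (dist_op n v)"

text \<open>For \<open>v\<close> in layer 2, \<open>ascent\<close> is the highest layer that
  \<open>dist_op n v\<close> can meet and \<open>descent\<close> the lowest that
  \<open>dist_op (n + 2) v\<close> can meet.\<close>

definition descent :: "'v \<Rightarrow> complex^'v \<Rightarrow> nat \<Rightarrow> complex^'v" where
  "descent x v n = proj x n (dist_op (n + 2) v)"

lemma proj_ascent: "proj x j (ascent x v n) = (if j = n + 2 then ascent x v n else 0)"
  by (simp add: ascent_def proj_proj)

lemma proj_descent: "proj x j (descent x v n) = (if j = n then descent x v n else 0)"
  by (simp add: descent_def proj_proj)

lemma ascent_0: "proj x 2 v = v \<Longrightarrow> ascent x v 0 = v"
  by (simp add: ascent_def dist_op_0_eq numeral_2_eq_2)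

lemma A_op_split:
  assumes "proj x (Suc j) f = f"
  shows "A_op f = proj x (Suc (Suc j)) (A_op f) + proj x j (A_op f)"
proof -
  have "A_op f $ y = 0" if "d x y \<noteq> Suc (Suc j)" "d x y \<noteq> j" for y
  proof -
    have "proj x (d x y) (A_op (proj x (Suc j) f)) = 0"
      using that by (intro proj_A_op_proj_eq_0) auto
    then have "proj x (d x y) (A_op (proj x (Suc j) f)) $ y = 0" by simp
    then show ?thesis unfolding assms by (simp add: proj_nth)
  qed
  then show ?thesis by (simp add: vec_eq_iff proj_nth)
qed

text \<open>Project the three-term recurrence to layer \<open>n + 3\<close>, which
  \<open>dist_op (n - 1) v\<close> does not reach, just as \<open>dist_op n v\<close> does not reach
  layer \<open>n + 4\<close>.\<close>

lemma proj_A_ascent_up: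
  assumes "proj x 2 v = v"
  shows "proj x (n + 3) (A_op (ascent x v n)) = of_nat (c (n + 1)) *s ascent x v (n + 1)"
proof -
  have "proj x (n + 4) (dist_op n v) = 0"
    by (rule proj_dist_op_eq_0[OF assms]) simp
  moreover have "proj x (n + 3) (dist_op (n - 1) v) = 0"
    by (rule proj_dist_op_eq_0[OF assms]) linarith
  ultimately show ?thesis
    using proj_A_op[of x "n + 2" "dist_op n v"]
    by (simp add: A_dist_op[unfolded One_nat_def] proj_add proj_scale ascent_def eval_nat_numeral
        split: if_splits)
qed

lemma proj_A_descent_down:
  assumes "proj x 2 v = v"
  shows "proj x (Suc n) (A_op (descent x v (n + 2))) = of_nat (b (n + 3)) *s descent x v (n + 1)"
proof -
  have "proj x n (dist_op (n + 4) v) = 0"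
    by (rule proj_dist_op_eq_0[OF assms]) simp
  moreover have "proj x (Suc n) (dist_op (n + 5) v) = 0"
    by (rule proj_dist_op_eq_0[OF assms]) simp
  ultimately show ?thesis
    using proj_A_op[of x n "dist_op (n + 4) v"]
    by (simp add: A_dist_op[unfolded One_nat_def] proj_add proj_scale descent_def eval_nat_numeral)
qed

text \<open>A vertex of layer \<open>j\<close> is at distance \<open>j - 2\<close>, \<open>j\<close>
  or \<open>j + 2\<close> from each vertex of layer 2, so the three terms collect the whole
  coordinate sum of \<open>v\<close>. This serves to eliminate the middle term.\<close>

lemma proj_dist_op_balance:
  assumes v: "proj x 2 v = v" and s: "(\<Sum>z\<in>UNIV. v $ z) = 0"
  shows "proj x j (dist_op j v) + descent x v j + (if j < 2 then 0 else ascent x v (j - 2)) = 0"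
proof -
  have "(\<Sum>z\<in>UNIV. if d y z = j then v $ z else 0) + (\<Sum>z\<in>UNIV. if d y z = j + 2 then v $ z else 0)
     + (if j < 2 then 0 else (\<Sum>z\<in>UNIV. if d y z = j - 2 then v $ z else 0)) = 0" if "d x y = j" for y
  proof -
    have "v $ z = (if d y z = j then v $ z else 0) + (if d y z = j + 2 then v $ z else 0)
      + (if j < 2 then 0 else if d y z = j - 2 then v $ z else 0)" for z
    proof (cases "d x z = 2")
      case True
      have "d y z \<le> j + 2" "j \<le> d y z + 2" "even (j + d y z + 2)"
        using gdist_triangle[of y z x] gdist_triangle[of x y z] gdist_parity[of x y z] that True
        by (auto simp: gdist_sym[of y x] gdist_sym[of z y])
      moreover have "m = j \<or> m = j + 2 \<or> (j \<ge> 2 \<and> m = j - 2)"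
        if "m \<le> j + 2" "j \<le> m + 2" "even (j + m + 2)" for m
        using that by presburger
      ultimately have "d y z = j \<or> d y z = j + 2 \<or> (j \<ge> 2 \<and> d y z = j - 2)" by blast
      then show ?thesis by auto
    next
      case False
      have "v $ z = proj x 2 v $ z" using v by simp
      with False show ?thesis by (simp add: proj_nth)
    qed
    then have "(\<Sum>z\<in>UNIV. v $ z) = (\<Sum>z\<in>UNIV. (if d y z = j then v $ z else 0) + (if d y z = j + 2 then v $ z else 0)
      + (if j < 2 then 0 else if d y z = j - 2 then v $ z else 0))"
      by (rule sum.cong[OF refl])
    then show ?thesis using s by (auto simp: sum.distrib)
  qed
  then show ?thesis
    by (auto simp: vec_eq_iff proj_nth dist_op_nth descent_def ascent_def)
qed

text \<open>Project the recurrence for \<open>dist_op (n + 1) v\<close> to layer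
  \<open>n + 2\<close> and replace both middle terms by ascents and descents.\<close>

lemma proj_A_ascent_down:
  assumes v: "proj x 2 v = v" and s: "(\<Sum>z\<in>UNIV. v $ z) = 0"
  shows "proj x (n + 2) (A_op (ascent x v (n + 1))) =
    of_nat (b (n + 2)) *s ascent x v n - of_nat (c (n + 2)) *s descent x v (n + 2)
    + proj x (n + 2) (A_op (descent x v (n + 1)))"
proof -
  let ?m = "\<lambda>n. proj x n (dist_op n v)"
  define prev where "prev = (if n = 0 then 0 else ascent x v (n - 1))"
  have m2: "?m (n + 2) = - ascent x v n - descent x v (n + 2)"
    using proj_dist_op_balance[OF v s, of "n + 2"] by (simp add: algebra_simps eq_neg_iff_add_eq_0)
  have m1: "?m (n + 1) = - descent x v (n + 1) - prev"
    using proj_dist_op_balance[OF v s, of "n + 1"] by (auto simp: prev_def algebra_simps eq_neg_iff_add_eq_0 numeral_2_eq_2)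
  \<comment> \<open>At \<open>n = 0\<close> there is no previous ascent, and \<open>c 0 = 0\<close>
    matches.\<close>
  have lo: "proj x (n + 2) (A_op prev) = of_nat (c n) *s ascent x v n"
  proof (cases n)
    case (Suc m)
    then show ?thesis using proj_A_ascent_up[OF v, of m] by (simp add: prev_def eval_nat_numeral)
  qed (simp add: prev_def)
  have "proj x (n + 2) (A_op (ascent x v (n + 1))) + proj x (n + 2) (A_op (?m (n + 1)))
      = proj x (n + 2) (A_op (dist_op (n + 1) v))"
    using proj_A_op[of x "n + 1" "dist_op (n + 1) v"] by (simp add: ascent_def eval_nat_numeral)
  also have "\<dots> = of_nat (c (n + 2)) *s ?m (n + 2) + of_nat (b n) *s ascent x v n"
    by (simp add: A_dist_op[unfolded One_nat_def] proj_add proj_scale ascent_def)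
  also have "proj x (n + 2) (A_op (?m (n + 1))) =
      - proj x (n + 2) (A_op (descent x v (n + 1))) - of_nat (c n) *s ascent x v n"
    unfolding m1 by (simp add: dist_op_diff dist_op_minus proj_diff proj_minus lo[unfolded add_2_eq_Suc'] del: One_nat_def)
  finally have *: "proj x (n + 2) (A_op (ascent x v (n + 1))) =
      of_nat (c (n + 2)) *s (- ascent x v n - descent x v (n + 2)) + of_nat (b n) *s ascent x v n
      + proj x (n + 2) (A_op (descent x v (n + 1))) + of_nat (c n) *s ascent x v n"
    unfolding m2 by (simp add: algebra_simps)
  \<comment> \<open>Both sums equal \<open>k\<close>, so \<open>b n + c n - c (n + 2)\<close>
    becomes \<open>b (n + 2)\<close>.\<close>
  have "of_nat (c n) + of_nat (b n) = (of_nat (c (n + 2)) + of_nat (b (n + 2)) :: complex)"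
    using c_add_b[of n] c_add_b[of "n + 2"] by (simp flip: of_nat_add)
  then have bn: "of_nat (b n) = of_nat (c (n + 2)) + of_nat (b (n + 2)) - (of_nat (c n) :: complex)"
    by (simp add: algebra_simps)
  show ?thesis unfolding * bn by (simp add: vec_eq_iff algebra_simps)
qed

text \<open>As \<open>A_op\<close> is self-adjoint, its part raising layer \<open>n + 2\<close> to
  \<open>n + 3\<close> is adjoint to the part lowering back.\<close>

lemma ascent_norm:
  assumes v: "proj x 2 v = v" and a: "proj x (n + 2) (A_op (ascent x v (n + 1))) = a *s ascent x v n"
  shows "of_nat (c (n + 1)) * cinner (ascent x v (n + 1)) (ascent x v (n + 1))
    = cnj a * cinner (ascent x v n) (ascent x v n)"
proof -
  let ?u = "ascent x v"
  have "of_nat (c (n + 1)) * cinner (?u (n + 1)) (?u (n + 1)) = cinner (proj x (n + 3) (A_op (?u n))) (?u (n + 1))"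
    unfolding proj_A_ascent_up[OF v] by (simp add: cinner_scale)
  also have "\<dots> = cinner (?u n) (A_op (?u (n + 1)))"
    by (simp add: cinner_proj cinner_A_op[unfolded One_nat_def] proj_ascent)
  also have "\<dots> = cinner (proj x (n + 2) (?u n)) (A_op (?u (n + 1)))"
    by (simp add: proj_ascent)
  also have "\<dots> = cnj a * cinner (?u n) (?u n)"
    unfolding cinner_proj a by (simp add: cinner_scale)
  finally show ?thesis .
qed

section \<open>Modules of the Terwilliger algebra\<close>

lemma terwilliger_algebra_induct [consumes 1, case_names A proj one add scale mult]:
  assumes "B \<in> terwilliger_algebra E x"
    and "P (adj_matrix E)" and "\<And>j. j \<le> D \<Longrightarrow> P (dual_idem E x j)" and "P (mat 1)"
    and "\<And>M N. P M \<Longrightarrow> P N \<Longrightarrow> P (M + N)" and "\<And>a M. P M \<Longrightarrow> P (\<chi> y z. a * M $ y $ z)"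
    and "\<And>M N. P M \<Longrightarrow> P N \<Longrightarrow> P (M ** N)"
  shows "P B"
  using assms(1) unfolding terwilliger_algebra_def
  by (induction rule: matrix_algebra.induct) (use assms(2-) in auto)

lemma scale_matrix_mult: "(\<chi> y z. a * M $ y $ z) *v w = a *s (M *v w :: complex^'v)"
  by (simp add: matrix_vector_mult_def vec_eq_iff sum_distrib_left mult.assoc)

text \<open>Invariance under the generators extends to the algebra by induction. All
  \<open>j\<close> may be allowed, as \<open>proj x j\<close> is zero beyond the diameter.\<close>

lemma T_module_iff:
  "T_module E x W \<longleftrightarrow> vec.subspace W \<and> (\<forall>w\<in>W. A_op w \<in> W) \<and> (\<forall>j. \<forall>w\<in>W. proj x j w \<in> W)"
proof safe
  assume W: "T_module E x W"
  then show sub: "vec.subspace W" by (simp add: T_module_def)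
  have "adj_matrix E \<in> terwilliger_algebra E x" and *: "j \<le> D \<Longrightarrow> dual_idem E x j \<in> terwilliger_algebra E x" for j
    unfolding terwilliger_algebra_def by (auto intro: matrix_algebra.gen)
  then show "A_op w \<in> W" if "w \<in> W" for w
    using W that unfolding T_module_def adj_matrix_mult[symmetric] by blast
  show "proj x j w \<in> W" if "w \<in> W" for j w
  proof (cases "j \<le> D")
    case True
    then show ?thesis using * W that unfolding T_module_def dual_idem_mult[symmetric] by blast
  next
    case False
    then have "proj x j w = 0" using gdist_le_diam[of x] by (auto simp: vec_eq_iff proj_nth)
    then show ?thesis using sub vec.subspace_0 by simp
  qed
next
  assume sub: "vec.subspace W" and A: "\<forall>w\<in>W. A_op w \<in> W" and p: "\<forall>j. \<forall>w\<in>W. proj x j w \<in> W"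
  have "\<forall>w\<in>W. B *v w \<in> W" if "B \<in> terwilliger_algebra E x" for B
    using that
  proof (induction rule: terwilliger_algebra_induct)
    case (mult M N)
    then show ?case by (simp flip: matrix_vector_mul_assoc)
  qed (use A p sub in \<open>auto simp: adj_matrix_mult dual_idem_mult scale_matrix_mult
      matrix_vector_mult_add_rdistrib vec.subspace_add vec.subspace_scale\<close>)
  then show "T_module E x W" using sub by (simp add: T_module_def)
qed

text \<open>\<open>dist_op n\<close> is a polynomial in \<open>A_op\<close>: the recurrence can be
  solved for its leading term because \<open>c (Suc m)\<close> is positive for every
  \<open>m\<close>.\<close>

lemma T_module_dist_op:
  assumes W: "T_module E x W" and w: "w \<in> W"
  shows "dist_op n w \<in> W"
proof (induction n rule: less_induct)
  case (less n)
  note W' = W[unfolded T_module_iff]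
  show ?case
  proof (cases n)
    case 0
    then show ?thesis using w by (simp add: dist_op_0_eq)
  next
    case (Suc m)
    have "dist_op n w = (1 / of_nat (c n)) *s (A_op (dist_op m w)
        - (if m = 0 then 0 else of_nat (b (m - 1)) *s dist_op (m - 1) w))"
      unfolding A_dist_op Suc using c_pos[of m] by (simp add: vec_eq_iff)
    moreover have "A_op (dist_op m w) \<in> W" "m \<noteq> 0 \<Longrightarrow> dist_op (m - 1) w \<in> W"
      using less Suc W' by auto
    ultimately show ?thesis
      using W' by (auto intro!: vec.subspace_scale vec.subspace_diff vec.subspace_0)
  qed
qed

lemma thin_proportional:
  assumes "thin E x W" "u \<in> W" "w \<in> W" "proj x j u = u" "proj x j w = w" "u \<noteq> 0"
  shows "\<exists>a. w = a *s u"
proof (rule ccontr)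
  assume no: "\<not> ?thesis"
  \<comment> \<open>\<open>thin\<close> speaks of layers up to \<open>D\<close>; a nonzero vector in
    layer \<open>j\<close> shows that \<open>j\<close> is one of them.\<close>
  obtain y where "u $ y \<noteq> 0" using assms(6) by (auto simp: vec_eq_iff)
  moreover have "u $ y = proj x j u $ y" using assms(4) by simp
  ultimately have "j \<le> D" using gdist_le_diam[of x y] by (auto simp: proj_nth split: if_splits)
  then have dim: "vec.dim (proj x j ` W) \<le> 1"
    using assms(1) by (simp add: thin_def dual_idem_mult)
  have "w \<notin> vec.span {u}" using no by (auto simp: vec.span_singleton)
  then have "vec.independent {w, u}" "w \<noteq> u"
    using assms(6) vec.independent_insertI[of w "{u}"] vec.span_base[of u "{u}"] by auto
  moreover have "{w, u} \<subseteq> proj x j ` W"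
    using assms by (metis (no_types) empty_subsetI image_eqI insert_subset)
  ultimately show False
    using vec.independent_card_le_dim[of "{w, u}" "proj x j ` W"] dim by simp
qed

end

section \<open>A thin irreducible module of endpoint 2\<close>

locale thin_endpoint_2 = bipartite_drg E k for E :: "'v::finite \<Rightarrow> 'v \<Rightarrow> bool" and k :: nat +
  fixes x :: 'v and W :: "(complex^'v) set" and v :: "complex^'v"
  assumes irr: "irreducible_T_module E x W" and endpt: "endpoint E x W = 2"
    and thin: "thin E x W" and v_in: "v \<in> W" and proj_v: "proj x 2 v = v" and v_nz: "v \<noteq> 0"
begin

abbreviation "u \<equiv> ascent x v"
abbreviation "u' \<equiv> descent x v"

lemma module: "T_module E x W" using irr by (simp add: irreducible_T_module_def)

lemma sub: "vec.subspace W" and A_in: "w \<in> W \<Longrightarrow> A_op w \<in> W" and proj_in: "w \<in> W \<Longrightarrow> proj x j w \<in> W"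
  using module by (auto simp: T_module_iff)

lemma u_in: "u n \<in> W" and u'_in: "u' n \<in> W"
  by (auto simp: ascent_def descent_def intro: proj_in T_module_dist_op[OF module v_in])

lemma proj_low: assumes "w \<in> W" "j < 2" shows "proj x j w = 0"
proof -
  have "proj x j ` W = {0}"
    using not_less_Least[of j "\<lambda>i. (\<lambda>w. dual_idem E x i *v w) ` W \<noteq> {0}"] endpt assms(2)
    by (simp add: endpoint_def dual_idem_mult)
  then show ?thesis using assms(1) by blast
qed

text \<open>The distance matrices add up to the all-ones matrix, which maps \<open>v\<close> into
  \<open>W\<close> with this sum as the coordinate at \<open>x\<close>; but \<open>W\<close> has no
  component in layer 0.\<close>

lemma sum_v: "(\<Sum>z\<in>UNIV. v $ z) = 0"
proof -
  have "(\<chi> y. \<Sum>z\<in>UNIV. v $ z) \<in> W"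
    unfolding sum_dist_op[symmetric] by (intro vec.subspace_sum sub T_module_dist_op[OF module v_in])
  from proj_low[OF this, of 0] have "proj x 0 (\<chi> y. \<Sum>z\<in>UNIV. v $ z) $ x = 0" by simp
  then show ?thesis by (simp add: proj_nth)
qed

lemma u_Suc_0: "u n = 0 \<Longrightarrow> u (n + 1) = 0"
  using proj_A_ascent_up[OF proj_v, of n] c_pos[of n] by simp

text \<open>By \<open>ascent_norm\<close> the scalar is \<open>c (n + 1)\<close> times the quotient
  of the squared norms of \<open>u (n + 1)\<close> and \<open>u n\<close>.\<close>

lemma ascent_norm_real:
  assumes "proj x (n + 2) (A_op (u (n + 1))) = a *s u n" "u n \<noteq> 0"
  obtains r where "a = of_real r" "r \<ge> 0" "r = 0 \<longleftrightarrow> u (n + 1) = 0"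
proof -
  define N where "N w = (\<Sum>y\<in>UNIV. (cmod (w $ y))\<^sup>2)" for w :: "complex^'v"
  have N: "cinner w w = of_real (N w)" "w \<noteq> 0 \<Longrightarrow> N w > 0" "N w \<ge> 0" "N 0 = 0" for w :: "complex^'v"
    using cinner_self[of w] cinner_self_pos[of w] by (auto simp: N_def sum_nonneg)
  define r where "r = c (n + 1) * N (u (n + 1)) / N (u n)"
  have "cnj a = of_real r"
    using ascent_norm[OF proj_v assms(1)] N(2)[OF assms(2)] unfolding N(1) r_def
    by (simp add: field_simps)
  then have "a = of_real r" by (metis complex_cnj_cnj complex_cnj_complex_of_real)
  moreover have "r \<ge> 0" using N(3) by (simp add: r_def)
  moreover have "r = 0 \<longleftrightarrow> u (n + 1) = 0"
    using N(2)[OF assms(2)] N(2)[of "u (n + 1)"] N(4) c_pos[of n]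
    by (cases "u (n + 1) = 0") (auto simp: r_def)
  ultimately show thesis using that by blast
qed

lemma descent_1: "u' 1 = 0"
  using proj_low[OF u'_in, of 1 1] by (simp add: proj_descent)

lemma proj_A_descent_1: "proj x j (dist_op (Suc 0) (u' (Suc 0))) = 0"
  using descent_1 by simp

text \<open>Thinness gives a complex scalar \<open>a\<close>; it is real because
  \<open>b 2 - c 2 * a\<close> is the coefficient that lowers \<open>u 1\<close> to
  \<open>u 0\<close>, a real number by \<open>ascent_norm_real\<close>.\<close>

lemma ex_t: "\<exists>t :: real. u' 2 = of_real t *s v"
proof -
  obtain a where a: "u' 2 = a *s v"
    using thin_proportional[OF thin v_in u'_in proj_v, of 2] v_nz by (auto simp: proj_descent)
  have "proj x (0 + 2) (A_op (u (0 + 1))) = (of_nat (b 2) - of_nat (c 2) * a) *s u 0"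
    unfolding proj_A_ascent_down[OF proj_v sum_v]
    by (simp add: proj_A_descent_1 a ascent_0[OF proj_v] numeral_2_eq_2[symmetric] vec_eq_iff algebra_simps)
  moreover have "u 0 \<noteq> 0" using v_nz ascent_0[OF proj_v] by simp
  ultimately obtain r where r: "of_nat (b 2) - of_nat (c 2) * a = of_real r"
    using ascent_norm_real by metis
  have "c 2 > 0" using c_pos[of 1] by (simp add: numeral_2_eq_2)
  then have "a = of_real ((b 2 - r) / c 2)" using r by (simp add: field_simps)
  with a show ?thesis by blast
qed

definition t :: real where "t = (SOME t. u' 2 = of_real t *s v)"

lemma descent_2: "u' 2 = of_real t *s v"
  unfolding t_def using ex_t by (rule someI_ex)

text \<open>Thinness makes each descent a multiple of the nonzero ascent in its layer. Lowering by
  one layer determines the factor recursively, so it depends on \<open>t\<close> alone.\<close>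

lemma ladder:
  assumes "u n \<noteq> 0"
  shows "u' (n + 2) = of_real (\<tau> t n) *s u n \<and>
    proj x (n + 2) (A_op (u (n + 1))) = of_real (\<kappa> t n) *s u n"
  using assms
proof (induction n)
  case 0
  show ?case
    using descent_2 unfolding proj_A_ascent_down[OF proj_v sum_v]
    by (simp add: proj_A_descent_1 ascent_0[OF proj_v] \<kappa>_def numeral_2_eq_2[symmetric] vec_eq_iff algebra_simps)
next
  case (Suc n)
  then have nz: "u n \<noteq> 0" using u_Suc_0 by auto
  with Suc.IH have IH: "u' (n + 2) = of_real (\<tau> t n) *s u n"
    "proj x (n + 2) (A_op (u (n + 1))) = of_real (\<kappa> t n) *s u n" by auto
  have \<kappa>: "\<kappa> t n \<noteq> 0" using ascent_norm_real[OF IH(2) nz] Suc.prems by (metis Suc_eq_plus1 of_real_eq_iff)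
  obtain a where a: "u' (n + 3) = a *s u (n + 1)"
    using thin_proportional[OF thin u_in[of "n + 1"] u'_in[of "n + 3"], of "n + 3"] Suc.prems
    by (auto simp: proj_descent proj_ascent eval_nat_numeral)
  \<comment> \<open>\<open>u' (n + 3)\<close> is lowered in two ways: directly, and as
    \<open>a\<close> times \<open>u (n + 1)\<close>.\<close>
  have "(a * of_real (\<kappa> t n)) *s u n = of_nat (b (n + 4)) *s u' (n + 2)"
    using proj_A_descent_down[OF proj_v, of "n + 1"] IH(2) a
    by (simp add: dist_op_scale[of 1, unfolded One_nat_def] proj_scale eval_nat_numeral)
  also have "\<dots> = (of_nat (b (n + 4)) * of_real (\<tau> t n)) *s u n" using IH(1) by simp
  finally have "a * of_real (\<kappa> t n) = of_nat (b (n + 4)) * of_real (\<tau> t n)"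
    using nz by (simp only: vec.scale_right_imp_eq)
  then have a': "a = of_real (\<tau> t (Suc n))" using \<kappa> by (simp add: \<tau>_Suc field_simps)
  have 1: "u' (Suc n + 2) = of_real (\<tau> t (Suc n)) *s u (Suc n)"
    using a unfolding a' by (simp add: eval_nat_numeral)
  have "proj x (Suc n + 2) (A_op (u' (Suc n + 1))) = (of_real (\<tau> t n) * of_nat (c (n + 1))) *s u (n + 1)"
    using IH(1) proj_A_ascent_up[OF proj_v, of n]
    by (simp add: dist_op_scale[of 1, unfolded One_nat_def] proj_scale eval_nat_numeral)
  then have "proj x (Suc n + 2) (A_op (u (Suc n + 1))) = of_real (\<kappa> t (Suc n)) *s u (Suc n)"
    unfolding proj_A_ascent_down[OF proj_v sum_v] 1
    by (simp add: \<kappa>_def vec_eq_iff algebra_simps)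
  with 1 show ?case by blast
qed

lemma A_u_0: "A_op (u 0) = of_nat (c 1) *s u 1"
  using A_op_split[of x 1 "u 0"] proj_low[OF A_in[OF u_in], of 1 0] proj_A_ascent_up[OF proj_v, of 0]
  by (simp add: proj_ascent numeral_2_eq_2 numeral_3_eq_3)

lemma A_u_Suc: "A_op (u (n + 1)) = of_nat (c (n + 2)) *s u (n + 2) + of_real (\<kappa> t n) *s u n"
proof -
  have "A_op (u (n + 1)) = proj x (n + 4) (A_op (u (n + 1))) + proj x (n + 2) (A_op (u (n + 1)))"
    using A_op_split[of x "n + 2" "u (n + 1)"] by (simp add: proj_ascent eval_nat_numeral)
  also have "proj x (n + 4) (A_op (u (n + 1))) = of_nat (c (n + 2)) *s u (n + 2)"
    using proj_A_ascent_up[OF proj_v, of "n + 1"] by (simp add: eval_nat_numeral)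
  also have "proj x (n + 2) (A_op (u (n + 1))) = of_real (\<kappa> t n) *s u n"
    using ladder[of n] u_Suc_0[of n] by (cases "u n = 0") auto
  finally show ?thesis .
qed

lemma \<kappa>_nonneg: "u n \<noteq> 0 \<Longrightarrow> \<kappa> t n \<ge> 0"
  and \<kappa>_eq_0_iff: "u n \<noteq> 0 \<Longrightarrow> \<kappa> t n = 0 \<longleftrightarrow> u (n + 1) = 0"
  using ladder[of n] ascent_norm_real[of n "of_real (\<kappa> t n)"] by (metis of_real_eq_iff)+

text \<open>The span is closed under \<open>A_op\<close> by \<open>A_u_0\<close> and
  \<open>A_u_Suc\<close>, and it is nonzero, so irreducibility makes it all of
  \<open>W\<close>.\<close>

lemma W_eq_span: "W = vec.span (range u)"
proof -
  have "u m \<in> vec.span (range u)" for m by (auto intro: vec.span_base)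
  then have A_u: "A_op (u n) \<in> vec.span (range u)" for n
    using A_u_0 A_u_Suc[of "n - 1"] by (cases n) (simp_all add: vec.span_add vec.span_scale)
  have "A_op w \<in> vec.span (range u)" if "w \<in> vec.span (range u)" for w
    using that by (induction rule: vec.span_induct_alt)
      (auto simp: dist_op_add dist_op_scale vec.span_zero intro!: vec.span_add vec.span_scale A_u[unfolded One_nat_def])
  moreover have proj_u: "proj x j (u n) \<in> vec.span (range u)" for n j
    by (auto simp: proj_ascent vec.span_zero intro!: vec.span_base)
  have "proj x j w \<in> vec.span (range u)" if "w \<in> vec.span (range u)" for w j
    using that by (induction rule: vec.span_induct_alt)
      (auto simp: proj_add proj_scale vec.span_zero intro!: vec.span_add vec.span_scale proj_u)
  ultimately have "T_module E x (vec.span (range u))"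
    by (simp add: T_module_iff vec.subspace_span)
  moreover have "vec.span (range u) \<subseteq> W"
    using u_in sub by (intro vec.span_minimal) auto
  moreover have "u 0 \<in> vec.span (range u)" "u 0 \<noteq> 0"
    using v_nz ascent_0[OF proj_v] vec.span_base[OF rangeI, of u 0] by auto
  ultimately show ?thesis using irr unfolding irreducible_T_module_def by blast
qed

text \<open>If \<open>u (n + 1)\<close> were zero, layer \<open>n + 3\<close> of \<open>W\<close>
  would be zero, so the descent there would vanish and, after lowering,
  \<open>\<tau> t n = 0\<close>. Then \<open>t = 0\<close>, all \<open>\<tau> t m\<close> vanish and
  \<open>\<kappa> t n = b (n + 2) > 0\<close>, contrary to \<open>\<kappa>_eq_0_iff\<close>.\<close>

lemma u_nonzero: "n + 4 \<le> D \<Longrightarrow> u n \<noteq> 0"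
proof (induction n)
  case 0
  show ?case using v_nz by (simp add: ascent_0[OF proj_v])
next
  case (Suc n)
  then have nz: "u n \<noteq> 0" by simp
  show ?case
  proof
    assume z: "u (Suc n) = 0"
    have proj_u: "proj x (n + 3) (u m) = 0" for m
      using z by (cases "m = Suc n") (auto simp: proj_ascent)
    have "proj x (n + 3) w = 0" if "w \<in> W" for w
      using that unfolding W_eq_span
      by (induction rule: vec.span_induct_alt) (use proj_u in \<open>auto simp: proj_add proj_scale\<close>)
    from this[OF u'_in[of "n + 3"]] have "u' (n + 3) = 0" by (simp add: proj_descent)
    then have "of_nat (b (n + 4)) *s u' (n + 2) = 0"
      using proj_A_descent_down[OF proj_v, of "n + 1"] by (simp add: eval_nat_numeral)
    moreover have "b (n + 4) > 0" using b_pos Suc.prems by simp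
    ultimately have "u' (n + 2) = 0" by simp
    then have \<tau>: "\<tau> t n = 0" using ladder[OF nz] nz by simp
    have "u m \<noteq> 0" if "m \<le> n" for m
      using that nz by (induction rule: inc_induct) (use u_Suc_0 in auto)
    then have "\<kappa> t m > 0" if "m < n" for m
      using \<kappa>_nonneg[of m] \<kappa>_eq_0_iff[of m] that by (force simp: less_le)
    then have "t = 0" using sgn_\<tau>[of n t] \<tau> Suc.prems by (simp add: sgn_0_0)
    then have "\<tau> t m = 0" for m by (induction m) (auto simp: \<tau>_Suc)
    then have "\<kappa> t n = b (n + 2)" by (simp add: \<kappa>_def)
    then show False using \<kappa>_eq_0_iff[OF nz] z b_pos[of "n + 2"] Suc.prems by simp
  qed
qed


end

section \<open>Isomorphism of modules with equal \<open>t\<close>, and the effect of a constant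
  count\<close>

context bipartite_drg begin

text \<open>
  The linear map \<open>ascent x v n \<mapsto> ascent x v' n\<close>. The vectors \<open>ascent x v n\<close> have disjoint supports,
  so a coefficient can be read off at any one coordinate of the support; for a zero vector it is
  \<open>w $ y / 0 = 0\<close>.
\<close>

definition transfer :: "'v \<Rightarrow> complex^'v \<Rightarrow> complex^'v \<Rightarrow> complex^'v \<Rightarrow> complex^'v" where
  "transfer x v v' w = (\<Sum>n\<le>D. let y = (SOME y. ascent x v n $ y \<noteq> 0)
     in (w $ y / ascent x v n $ y) *s ascent x v' n)"

lemma transfer_add: "transfer x v v' (w + w') = transfer x v v' w + transfer x v v' w'"
  by (simp add: transfer_def Let_def add_divide_distrib vec.scale_left_distrib sum.distrib)

lemma transfer_scale: "transfer x v v' (a *s w) = a *s transfer x v v' w"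
  by (simp add: transfer_def Let_def vec.scale_sum_right)

lemma transfer_0 [simp]: "transfer x v v' 0 = 0"
  by (simp add: transfer_def Let_def)

lemma ascent_nth: "d x y \<noteq> n + 2 \<Longrightarrow> ascent x v n $ y = 0"
  by (simp add: ascent_def proj_nth)

lemma transfer_ascent:
  assumes "\<And>n. ascent x v n = 0 \<longleftrightarrow> ascent x v' n = 0"
  shows "transfer x v v' (ascent x v m) = ascent x v' m"
proof -
  define y where "y n = (SOME y. ascent x v n $ y \<noteq> 0)" for n
  have y: "ascent x v n $ y n \<noteq> 0" if "ascent x v n \<noteq> 0" for n
  proof -
    have "\<exists>y. ascent x v n $ y \<noteq> 0" using that by (auto simp: vec_eq_iff)
    then show ?thesis unfolding y_def by (rule someI_ex)
  qed
  have "(ascent x v m $ y n / ascent x v n $ y n) *s ascent x v' n = (if n = m then ascent x v' m else 0)" for n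
  proof (cases "ascent x v n = 0")
    case True
    then have "ascent x v' n = 0" using assms by blast
    then show ?thesis by auto
  next
    case False
    then have "d x (y n) = n + 2" using y ascent_nth by blast
    then show ?thesis using y[OF False] ascent_nth[of x "y n" m v] by auto
  qed
  then have "transfer x v v' (ascent x v m) = (if m \<le> D then ascent x v' m else 0)"
    by (simp add: transfer_def Let_def flip: y_def)
  moreover have "ascent x v' m = 0" if "m > D"
  proof -
    have "d x z \<noteq> m + 2" for z using gdist_le_diam[of x z] that by linarith
    then show ?thesis using ascent_nth by (simp add: vec_eq_iff)
  qed
  ultimately show ?thesis by simp
qed

text \<open>\<open>A_op\<close> acts on both families of ascents with coefficients that depend only
  on the common \<open>t\<close>, and the same ascents vanish; so matching them is a well-defined
  isomorphism.\<close>

lemma isomorphic_if_equal_parameter: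
  assumes U: "thin_endpoint_2 E k x U v" and V: "thin_endpoint_2 E k x V v'"
    and t: "thin_endpoint_2.t E x v = thin_endpoint_2.t E x v'"
  shows "isomorphic_T_modules E x U V"
proof -
  interpret U: thin_endpoint_2 E k x U v by fact
  interpret V: thin_endpoint_2 E k x V v' by fact
  have zero: "U.u n = 0 \<longleftrightarrow> V.u n = 0" for n
  proof (induction n)
    case 0
    then show ?case using U.v_nz V.v_nz by (simp add: ascent_0 U.proj_v V.proj_v)
  next
    case (Suc n)
    then show ?case
      using U.u_Suc_0[of n] V.u_Suc_0[of n] U.\<kappa>_eq_0_iff[of n] V.\<kappa>_eq_0_iff[of n] t by auto
  qed
  let ?f = "transfer x v v'" and ?g = "transfer x v' v"
  have f: "?f (U.u n) = V.u n" and g: "?g (V.u n) = U.u n" for n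
    using transfer_ascent[of x v v'] transfer_ascent[of x v' v] zero by auto
  have fU: "?f w \<in> V" if "w \<in> U" for w
    using that unfolding U.W_eq_span
    by (induction rule: vec.span_induct_alt)
      (auto simp: transfer_add transfer_scale f V.sub vec.subspace_0
        intro!: vec.subspace_add vec.subspace_scale V.sub V.u_in)
  have gV: "?g w \<in> U" if "w \<in> V" for w
    using that unfolding V.W_eq_span
    by (induction rule: vec.span_induct_alt)
      (auto simp: transfer_add transfer_scale g U.sub vec.subspace_0
        intro!: vec.subspace_add vec.subspace_scale U.sub U.u_in)
  have gf: "?g (?f w) = w" if "w \<in> U" for w
    using that unfolding U.W_eq_span
    by (induction rule: vec.span_induct_alt) (auto simp: transfer_add transfer_scale f g)
  have fg: "?f (?g w) = w" if "w \<in> V" for w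
    using that unfolding V.W_eq_span
    by (induction rule: vec.span_induct_alt) (auto simp: transfer_add transfer_scale f g)
  have fA_u: "?f (A_op (U.u n)) = A_op (?f (U.u n))" for n
  proof (cases n)
    case 0
    then show ?thesis using U.A_u_0 V.A_u_0 by (simp add: transfer_scale f)
  next
    case (Suc m)
    then show ?thesis using U.A_u_Suc[of m] V.A_u_Suc[of m] t
      by (simp add: transfer_scale transfer_add f)
  qed
  have fA: "?f (A_op w) = A_op (?f w)" if "w \<in> U" for w
    using that unfolding U.W_eq_span
    by (induction rule: vec.span_induct_alt)
      (auto simp: transfer_add transfer_scale dist_op_add dist_op_scale fA_u[unfolded One_nat_def])
  have fproj_u: "?f (proj x j (U.u n)) = proj x j (V.u n)" for j n
    by (cases "j = n + 2") (simp_all add: proj_ascent f)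
  have fproj: "?f (proj x j w) = proj x j (?f w)" if "w \<in> U" for w j
    using that unfolding U.W_eq_span
    by (induction rule: vec.span_induct_alt)
      (auto simp: transfer_add transfer_scale proj_add proj_scale fproj_u f)
  \<comment> \<open>Membership in \<open>U\<close> is part of the claim because for a product
    \<open>M ** N\<close> the statement for \<open>M\<close> is applied to
    \<open>N *v w\<close>.\<close>
  have "\<forall>w\<in>U. B *v w \<in> U \<and> ?f (B *v w) = B *v ?f w" if "B \<in> terwilliger_algebra E x" for B
    using that
  proof (induction rule: terwilliger_algebra_induct)
    case (mult M N)
    then show ?case by (simp flip: matrix_vector_mul_assoc)
  qed (use U.A_in U.proj_in fA fproj U.sub in \<open>auto simp: adj_matrix_mult dual_idem_mult scale_matrix_mult
      matrix_vector_mult_add_rdistrib vec.subspace_add vec.subspace_scale transfer_add transfer_scale\<close>)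
  moreover have "bij_betw ?f U V"
    using gf fg fU gV by (intro bij_betw_byWitness[of U ?g]) auto
  ultimately show ?thesis
    unfolding isomorphic_T_modules_def by (intro exI[of _ ?f]) (auto simp: transfer_add transfer_scale)
qed

lemma ex_thin_endpoint_2:
  assumes "irreducible_T_module E x W" "endpoint E x W = 2" "thin E x W"
  shows "\<exists>v. thin_endpoint_2 E k x W v"
proof -
  have W: "T_module E x W" "W \<noteq> {0}" using assms(1) by (auto simp: irreducible_T_module_def)
  then have sub: "vec.subspace W" and proj_in: "\<And>j w. w \<in> W \<Longrightarrow> proj x j w \<in> W"
    by (auto simp: T_module_iff)
  obtain w where w: "w \<in> W" "w \<noteq> 0" using W(2) vec.subspace_0[OF sub] by blast
  \<comment> \<open>Some layer of \<open>W\<close> is nonzero, so the least index in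
    \<open>endpoint\<close> really has its defining property.\<close>
  have "\<exists>i. proj x i w \<noteq> 0"
    using w(2) sum_proj[of x w] by (metis sum.neutral)
  then have "\<exists>i. (\<lambda>w. dual_idem E x i *v w) ` W \<noteq> {0}"
    unfolding dual_idem_mult using w(1) by blast
  from LeastI_ex[OF this] have "proj x 2 ` W \<noteq> {0}"
    using assms(2) by (simp add: endpoint_def dual_idem_mult)
  moreover have "0 \<in> proj x 2 ` W" using vec.subspace_0[OF sub] by force
  ultimately obtain w' where "w' \<in> W" "proj x 2 w' \<noteq> 0" by blast
  then show ?thesis
    using assms proj_in by (intro exI[of _ "proj x 2 w'"]) (unfold_locales, auto simp: proj_proj)
qed

text \<open>Fix \<open>z\<close> in layer \<open>i\<close> and sum the counts against
  \<open>v\<close> over \<open>y\<close> in layer 2. A count is \<open>c 2\<close> if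
  \<open>d z y = i - 2\<close>, \<open>q\<close> if \<open>d z y = i\<close>, and 0 otherwise.
  Summing over the common neighbours \<open>w\<close> first gives coordinates of layer 1 of
  \<open>A_op v\<close>, which is zero; the balance relation then removes the middle term.\<close>

lemma (in thin_endpoint_2) sum_common_neighbours:
  assumes i: "2 \<le> i" and q: "\<And>y z. d x y = 2 \<Longrightarrow> d x z = i \<Longrightarrow> d y z = i \<Longrightarrow>
      card (sphere_at E 1 x \<inter> sphere_at E 1 y \<inter> sphere_at E (i - 1) z) = q"
  shows "(of_nat (c 2) - of_nat q) *s u (i - 2) = of_nat q *s u' i"
proof -
  let ?S = "\<lambda>y z. sphere_at E 1 x \<inter> sphere_at E 1 y \<inter> sphere_at E (i - 1) z"
  let ?m = "proj x i (dist_op i v)"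
  have vz: "v $ y = 0" if "d x y \<noteq> 2" for y
    using that proj_nth[of x 2 v y] proj_v by simp
  have cnt: "of_nat (card (?S y z)) * v $ y =
      of_nat (c 2) * (if d z y = i - 2 then v $ y else 0) + of_nat q * (if d z y = i then v $ y else 0)"
    if z: "d x z = i" for y z
  proof (cases "d x y = 2")
    case True
    have S: "?S y z = {w. d y w = 1 \<and> d x w = 1 \<and> d z w = i - 1}"
      by (auto simp: sphere_at_def gdist_sym)
    consider "d z y = i" | "d z y = i - 2" | "d z y \<noteq> i" "d z y \<noteq> i - 2" by blast
    then show ?thesis
    proof cases
      case 1
      then show ?thesis using q[OF True z] i by (simp add: gdist_sym)
    next
      case 2
      \<comment> \<open>\<open>w\<close> is adjacent to \<open>x\<close>, at distance
        \<open>i\<close> from \<open>z\<close>, and to \<open>y\<close>, at distance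
        \<open>i - 2\<close>; only \<open>i - 1\<close> fits both.\<close>
      have "d z w = i - 1" if "d y w = 1" "d x w = 1" for w
      proof -
        have "d z w = i + 1 \<or> i = d z w + 1" "d z w = i - 2 + 1 \<or> i - 2 = d z w + 1"
          using gdist_neighbour[OF that(1), of z] gdist_neighbour[OF that(2), of z] z 2
          by (auto simp: gdist_sym[of z x])
        then show ?thesis using i by linarith
      qed
      then have "?S y z = {w. d y w = 1 \<and> d x w = 1}" unfolding S by blast
      then show ?thesis using card_c[of x y 1] True 2 i by (simp add: numeral_2_eq_2)
    next
      case 3
      have "?S y z = {}"
      proof (rule ccontr)
        assume "?S y z \<noteq> {}"
        then obtain w where w: "d y w = 1" "d z w = i - 1" unfolding S by blast
        have "d w y = 1" using w(1) by (simp add: gdist_sym)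
        from gdist_neighbour[OF this, of z] show False using w(2) 3 i by auto
      qed
      then show ?thesis using 3 by (simp only: card.empty) simp
    qed
  next
    case False
    then show ?thesis using vz by simp
  qed
  have card_sum: "of_nat (card S) * a = (\<Sum>w\<in>UNIV. if w \<in> S then a else 0)" for S :: "'v set" and a :: complex
    by (simp add: sum.If_cases)
  have mem: "w \<in> ?S y z \<longleftrightarrow> d z w = i - 1 \<and> d x w = 1 \<and> d w y = 1" for w y z
    by (auto simp: sphere_at_def gdist_sym[of w y])
  have "of_nat (c 2) *s u (i - 2) + of_nat q *s ?m = 0"
  proof -
    have "of_nat (c 2) * (dist_op (i - 2) v $ z) + of_nat q * (dist_op i v $ z) = 0" if z: "d x z = i" for z
    proof -
      have "of_nat (c 2) * (dist_op (i - 2) v $ z) + of_nat q * (dist_op i v $ z) =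
          (\<Sum>y\<in>UNIV. of_nat (card (?S y z)) * v $ y)"
        unfolding cnt[OF z] by (simp add: dist_op_nth sum.distrib sum_distrib_left)
      also have "\<dots> = (\<Sum>y\<in>UNIV. \<Sum>w\<in>UNIV. if w \<in> ?S y z then v $ y else 0)"
        by (simp only: card_sum)
      also have "\<dots> = (\<Sum>w\<in>UNIV. \<Sum>y\<in>UNIV. if w \<in> ?S y z then v $ y else 0)"
        by (rule sum.swap)
      also have "\<dots> = (\<Sum>w\<in>UNIV. if d z w = i - 1 then proj x 1 (A_op v) $ w else 0)"
        unfolding mem proj_nth dist_op_nth by (intro sum.cong refl) auto
      also have "\<dots> = 0"
      proof -
        have "proj x 1 (A_op v) = 0" by (rule proj_low[OF A_in[OF v_in]]) simp
        then show ?thesis by (simp only: zero_index if_cancel sum.neutral_const)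
      qed
      finally show ?thesis .
    qed
    then show ?thesis
      using i by (auto simp: vec_eq_iff ascent_def proj_nth)
  qed
  moreover have "?m = - u (i - 2) - u' i"
    using proj_dist_op_balance[OF proj_v sum_v, of i] i
    by (simp add: algebra_simps eq_neg_iff_add_eq_0)
  ultimately show ?thesis by (simp add: vec_eq_iff algebra_simps)
qed

end

section \<open>Comparison of the two isomorphism classes\<close>

theorem theorem6p5:
  fixes E :: "'v::finite \<Rightarrow> 'v \<Rightarrow> bool" and x :: 'v
    and k i :: nat and \<alpha> \<beta> \<gamma> :: complex
  assumes "distance_regular E" and "bipartite_graph E"
    and "diam E \<ge> 4" and "has_valency E k" and "k \<ge> 3"
    and "two_thin_endpoint_2 E x"
    and "2 \<le> i" and "i \<le> diam E - 2"
    and "\<not> (\<alpha> = 0 \<and> \<beta> = 0 \<and> \<gamma> = 0)"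
    and "\<And>y z. gdist E x y = 2 \<Longrightarrow> gdist E x z = i \<Longrightarrow> gdist E y z = i \<Longrightarrow>
      \<alpha> + \<beta> * of_nat (card (sphere_at E 1 x \<inter> sphere_at E 1 y \<inter> sphere_at E (i - 1) z))
        + \<gamma> * of_nat (card (sphere_at E (i - 1) x \<inter> sphere_at E (i - 1) y \<inter> sphere_at E 1 z)) = 0"
  shows "\<gamma> \<noteq> 0"
proof
  assume \<gamma>: "\<gamma> = 0"
  interpret bipartite_drg E k by unfold_locales fact+
  let ?K = "\<lambda>y z. card (sphere_at E 1 x \<inter> sphere_at E 1 y \<inter> sphere_at E (i - 1) z)"
  have K: "\<alpha> + \<beta> * of_nat (?K y z) = 0" if "d x y = 2" "d x z = i" "d y z = i" for y z
    using assms(10)[OF that] \<gamma> by simp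
  obtain y0 z0 where yz: "d x y0 = 2" "d x z0 = i" "d y0 z0 = i"
    using exists_equidistant[OF assms(5), of i x] assms(3,7,8) by fastforce
  \<comment> \<open>With \<open>\<beta> = 0\<close> the relation at this pair would force
    \<open>\<alpha> = 0\<close> too.\<close>
  have \<beta>: "\<beta> \<noteq> 0" using K[OF yz] assms(9) \<gamma> by auto
  define q where "q = ?K y0 z0"
  have q: "?K y z = q" if "d x y = 2" "d x z = i" "d y z = i" for y z
  proof -
    have "\<beta> * of_nat (?K y z) = \<beta> * of_nat q"
      using K[OF yz] K[OF that] unfolding q_def by (metis add_left_cancel)
    then show ?thesis using \<beta> by simp
  qed
  have "q \<le> card {w. d y0 w = 1 \<and> d x w = 1}"
    unfolding q_def by (intro card_mono) (auto simp: sphere_at_def)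
  also have "\<dots> = c 2" using card_c[of x y0 1] yz(1) by (simp add: numeral_2_eq_2)
  finally have q_le: "q \<le> c 2" .
  have c2: "c 2 > 0" using c_pos[of 1] by (simp add: numeral_2_eq_2)
  have key: "of_nat q * \<tau> (thin_endpoint_2.t E x v) (i - 2) = of_nat (c 2) - of_nat q"
    and pos: "\<And>n. n < i - 2 \<Longrightarrow> \<kappa> (thin_endpoint_2.t E x v) n > 0"
    if "thin_endpoint_2 E k x W v" for W v
  proof -
    interpret thin_endpoint_2 E k x W v by fact
    have nz: "u (i - 2) \<noteq> 0" using u_nonzero[of "i - 2"] assms(3,7,8) by simp
    have i2: "i - 2 + 2 = i" using assms(7) by simp
    have u'_i: "u' i = of_real (\<tau> t (i - 2)) *s u (i - 2)"
      using ladder[OF nz, THEN conjunct1] unfolding i2 .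
    have "(of_nat (c 2) - of_nat q) *s u (i - 2) = (of_nat q * of_real (\<tau> t (i - 2))) *s u (i - 2)"
      using sum_common_neighbours[OF assms(7) q] unfolding u'_i vec.scale_scale .
    then have "of_nat (c 2) - of_nat q = of_nat q * complex_of_real (\<tau> t (i - 2))"
      using nz by (simp only: vec.scale_right_imp_eq)
    then have "complex_of_real (of_nat (c 2) - of_nat q) = of_real (of_nat q * \<tau> t (i - 2))" by simp
    then show "of_nat q * \<tau> t (i - 2) = of_nat (c 2) - of_nat q" by (simp only: of_real_eq_iff)
    fix n assume "n < i - 2"
    then have "u n \<noteq> 0" "u (n + 1) \<noteq> 0" using assms(3,8) by (auto intro!: u_nonzero)
    then show "\<kappa> t n > 0" using \<kappa>_nonneg[of n] \<kappa>_eq_0_iff[of n] by simp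
  qed
  \<comment> \<open>For \<open>q = 0\<close> the identity \<open>key\<close> would read
    \<open>0 = c 2\<close>.\<close>
  have q_pos: "q > 0" if "thin_endpoint_2 E k x W v" for W v
    using key[OF that] c2 by (cases q) auto
  obtain U V where
    "irreducible_T_module E x U" "endpoint E x U = 2" "thin E x U"
    "irreducible_T_module E x V" "endpoint E x V = 2" "thin E x V"
    and niso: "\<not> isomorphic_T_modules E x U V"
    using assms(6) unfolding two_thin_endpoint_2_def by blast
  then obtain v v' where U: "thin_endpoint_2 E k x U v" and V: "thin_endpoint_2 E k x V v'"
    using ex_thin_endpoint_2 by blast
  define s s' where "s = thin_endpoint_2.t E x v" "s' = thin_endpoint_2.t E x v'"
  have N: "i - 2 + 4 \<le> D" using assms(3,7,8) by simp
  have eq: "\<tau> s (i - 2) = (of_nat (c 2) - of_nat q) / of_nat q"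
    "\<tau> s' (i - 2) = (of_nat (c 2) - of_nat q) / of_nat q"
    using key[OF U] key[OF V] q_pos[OF U] by (simp_all add: s_s'_def field_simps)
  then have "\<tau> s (i - 2) \<ge> 0" using q_le by simp
  have \<kappa>: "\<kappa> s n > 0" "\<kappa> s' n > 0" if "n < i - 2" for n
    using pos[OF U that] pos[OF V that] by (simp_all add: s_s'_def)
  have sgn: "sgn s = sgn (\<tau> s (i - 2))" "sgn s' = sgn (\<tau> s (i - 2))"
    using sgn_\<tau>[OF \<kappa>(1) N] sgn_\<tau>[OF \<kappa>(2) N] eq by auto
  \<comment> \<open>The values of \<open>\<tau>\<close> at \<open>i - 2\<close> agree and are
    nonnegative, and \<open>\<tau>\<close> keeps the sign of its parameter: either both parameters
    are 0, or both are positive and strict monotonicity applies.\<close>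
  have "s = s'"
  proof (cases "\<tau> s (i - 2) = 0")
    case True
    then show ?thesis using sgn by (simp add: sgn_0_0)
  next
    case False
    then have "s > 0" "s' > 0" using sgn \<open>\<tau> s (i - 2) \<ge> 0\<close> by (auto simp: sgn_if split: if_splits)
    then show ?thesis
      using \<tau>_strict_mono[OF _ _ \<kappa> N] \<tau>_strict_mono[OF _ _ \<kappa>(2) \<kappa>(1) N] eq
      by (metis linorder_neq_iff less_irrefl)
  qed
  then show False using isomorphic_if_equal_parameter[OF U V] niso by (simp add: s_s'_def)
qed

end
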